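(* Let $R$ be a subring of a ring $T$, put $\mathcal{E}_{\mathcal{P}}=\{e=e^2\in T \mid e+\mathcal{P}(T) \text{ is central in } T/\mathcal{P}(T)\}$, let $\emptyset\neq\mathcal{E}\subseteq\mathcal{E}_{\mathcal{P}}$, and let $S=\langle R\cup\mathcal{E}\rangle_T$ be the subring of $T$ generated by $R\cup\mathcal{E}$. Then: (1) $\rho(R)=\rho(S)\cap R$, where $\rho$ is any special radical. (2) The classical Krull dimensions of $S$ and $R$ are equal. (3) If $S$ is a von Neumann regular ring, then so is $R$.
   Context: All rings are associative with unity; subrings contain the unity of the overring. $\mathcal{P}(T)$ denotes the prime radical of $T$. Special radicals are in the standard sense of radical theory (Gardner–Wiegandt): a special class $\mathcal{M}$ is a class of prime rings (not necessarily with unity), closed under isomorphism and under taking ideals, such that if $I$ is an essential ideal of a ring $A$ and $I\in\mathcal{M}$, then $A\in\mathcal{M}$; the associated special radical is the upper radical determined by $\mathcal{M}$, and it satisfies $\rho(A)=\bigcap\{I\trianglelefteq A \mid A/I\in\mathcal{M}\}$. For example, the prime, Jacobson and nil radicals are special. The classical Krull dimension is the one defined through chains of prime ideals. *)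

theory Defs
  imports "HOL-Algebra.Algebra" "HOL-Library.Extended_Real"
begin

section \<open>Rings not necessarily with unity\<close>

text \<open>
  Rings without unity are encoded in the record type of HOL-Algebra; the field \<open>one\<close> is ignored.
  In particular, isomorphisms below preserve only addition and multiplication, so that an
  isomorphism-closed class of such rings cannot depend on the value of that field.
\<close>

locale rng = abelian_group R for R (structure) +
  assumes rng_m_closed: "\<lbrakk> x \<in> carrier R; y \<in> carrier R \<rbrakk> \<Longrightarrow> x \<otimes> y \<in> carrier R"
    and rng_m_assoc: "\<lbrakk> x \<in> carrier R; y \<in> carrier R; z \<in> carrier R \<rbrakk>
      \<Longrightarrow> (x \<otimes> y) \<otimes> z = x \<otimes> (y \<otimes> z)"
    and rng_l_distr: "\<lbrakk> x \<in> carrier R; y \<in> carrier R; z \<in> carrier R \<rbrakk>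
      \<Longrightarrow> (x \<oplus> y) \<otimes> z = x \<otimes> z \<oplus> y \<otimes> z"
    and rng_r_distr: "\<lbrakk> x \<in> carrier R; y \<in> carrier R; z \<in> carrier R \<rbrakk>
      \<Longrightarrow> z \<otimes> (x \<oplus> y) = z \<otimes> x \<oplus> z \<otimes> y"

text \<open>For a ring with unity this agrees with \<^const>\<open>ideal\<close>, whose locale presupposes a unity.\<close>

locale rng_ideal = additive_subgroup I R + rng R for I and R (structure) +
  assumes rng_I_l_closed: "\<lbrakk> a \<in> I; x \<in> carrier R \<rbrakk> \<Longrightarrow> x \<otimes> a \<in> I"
    and rng_I_r_closed: "\<lbrakk> a \<in> I; x \<in> carrier R \<rbrakk> \<Longrightarrow> a \<otimes> x \<in> I"

definition rng_isomorphic :: "('a, 'm) ring_scheme \<Rightarrow> ('b, 'n) ring_scheme \<Rightarrow> bool" where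
  "rng_isomorphic A B \<longleftrightarrow>
     (\<exists>h. h \<in> hom A B \<and> h \<in> hom (add_monoid A) (add_monoid B) \<and>
          bij_betw h (carrier A) (carrier B))"

text \<open>
  The zero ring counts as a prime ring here: a nonempty class of prime rings that is closed under
  ideals necessarily contains it.
\<close>

definition prime_rng :: "('a, 'm) ring_scheme \<Rightarrow> bool" where
  "prime_rng A \<longleftrightarrow> rng A \<and>
     (\<forall>I J. rng_ideal I A \<longrightarrow> rng_ideal J A \<longrightarrow> I \<cdot>\<^bsub>A\<^esub> J \<subseteq> {\<zero>\<^bsub>A\<^esub>} \<longrightarrow>
        I = {\<zero>\<^bsub>A\<^esub>} \<or> J = {\<zero>\<^bsub>A\<^esub>})"

definition essential_ideal :: "'a set \<Rightarrow> ('a, 'm) ring_scheme \<Rightarrow> bool" where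
  "essential_ideal I A \<longleftrightarrow> rng_ideal I A \<and>
     (\<forall>J. rng_ideal J A \<longrightarrow> J \<noteq> {\<zero>\<^bsub>A\<^esub>} \<longrightarrow> I \<inter> J \<noteq> {\<zero>\<^bsub>A\<^esub>})"


section \<open>Special radicals\<close>

text \<open>
  A class of rings is a set of ring structures whose carriers are subsets of a type \<open>'u\<close>. To speak
  about the radical of a ring over a type \<open>'a\<close> we take \<open>'u = 'a set\<close>: this is the type of the
  elements of quotients, and it contains a copy of every ring whose cardinality is at most that of
  the power set of \<open>'a\<close>. The restriction of a special class of arbitrary rings to this type is a
  special class in the sense below, and it determines the same radical for rings over \<open>'a\<close>.
\<close>

definition special_class :: "'u ring set \<Rightarrow> bool" where
  "special_class M \<longleftrightarrow>
     (\<forall>A\<in>M. prime_rng A) \<and>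
     (\<forall>A\<in>M. \<forall>B. rng B \<longrightarrow> rng_isomorphic A B \<longrightarrow> B \<in> M) \<and>
     (\<forall>A\<in>M. \<forall>I. rng_ideal I A \<longrightarrow> A\<lparr>carrier := I\<rparr> \<in> M) \<and>
     (\<forall>A I. rng A \<longrightarrow> essential_ideal I A \<longrightarrow> A\<lparr>carrier := I\<rparr> \<in> M \<longrightarrow> A \<in> M)"

text \<open>
  Membership in the upper radical class determined by \<open>M\<close>: no nonzero homomorphic image of the ring
  belongs to \<open>M\<close>.
\<close>

definition upper_radical_class :: "'a set ring set \<Rightarrow> ('a, 'm) ring_scheme \<Rightarrow> bool" where
  "upper_radical_class M A \<longleftrightarrow> rng A \<and>
     (\<forall>I. rng_ideal I A \<longrightarrow> A Quot I \<in> M \<longrightarrow> I = carrier A)"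

text \<open>The sum of all ideals that, considered as rings, belong to the upper radical class.\<close>

definition upper_radical :: "'a set ring set \<Rightarrow> ('a, 'm) ring_scheme \<Rightarrow> 'a set" where
  "upper_radical M A =
     generate (add_monoid A) (\<Union>{I. rng_ideal I A \<and> upper_radical_class M (A\<lparr>carrier := I\<rparr>)})"


section \<open>Prime ideals of noncommutative rings with unity\<close>

text \<open>The library's \<^const>\<open>primeideal\<close> is restricted to commutative rings.\<close>

definition prime_ideal :: "'a set \<Rightarrow> ('a, 'm) ring_scheme \<Rightarrow> bool" where
  "prime_ideal P A \<longleftrightarrow> ideal P A \<and> P \<noteq> carrier A \<and>
     (\<forall>I J. ideal I A \<longrightarrow> ideal J A \<longrightarrow> I \<cdot>\<^bsub>A\<^esub> J \<subseteq> P \<longrightarrow> I \<subseteq> P \<or> J \<subseteq> P)"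

definition prime_radical :: "('a, 'm) ring_scheme \<Rightarrow> 'a set" where
  "prime_radical A = {x \<in> carrier A. \<forall>P. prime_ideal P A \<longrightarrow> x \<in> P}"

text \<open>
  The supremum of the lengths \<open>n\<close> of chains \<open>P\<^sub>0 \<subset> \<dots> \<subset> P\<^sub>n\<close> of prime ideals; it is
  \<open>\<infinity>\<close> if these lengths are unbounded and \<open>- \<infinity>\<close> for the zero ring.
\<close>

definition classical_krull_dim :: "('a, 'm) ring_scheme \<Rightarrow> ereal" where
  "classical_krull_dim A =
     Sup {ereal (real n) | n. \<exists>P :: nat \<Rightarrow> 'a set.
            (\<forall>i\<le>n. prime_ideal (P i) A) \<and> (\<forall>i<n. P i \<subset> P (Suc i))}"

definition von_neumann_regular :: "('a, 'm) ring_scheme \<Rightarrow> bool" where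
  "von_neumann_regular A \<longleftrightarrow>
     (\<forall>a\<in>carrier A. \<exists>x\<in>carrier A. a \<otimes>\<^bsub>A\<^esub> x \<otimes>\<^bsub>A\<^esub> a = a)"


section \<open>Idempotents central modulo the prime radical\<close>

definition central_in :: "('a, 'm) ring_scheme \<Rightarrow> 'a \<Rightarrow> bool" where
  "central_in A z \<longleftrightarrow>
     z \<in> carrier A \<and> (\<forall>x\<in>carrier A. z \<otimes>\<^bsub>A\<^esub> x = x \<otimes>\<^bsub>A\<^esub> z)"

definition idempotents_central_mod_prime_radical :: "('a, 'm) ring_scheme \<Rightarrow> 'a set" where
  "idempotents_central_mod_prime_radical A =
     {e \<in> carrier A. e \<otimes>\<^bsub>A\<^esub> e = e \<and>
        central_in (A Quot prime_radical A) (prime_radical A +>\<^bsub>A\<^esub> e)}"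

end

theory Submission
  imports Defs
begin

text \<open>
  Let \<open>e\<close> be one of the adjoined idempotents and \<open>P\<close> a prime ideal of \<open>S\<close>. The commutators of \<open>e\<close> with
  elements of \<open>S\<close> lie in the prime radical of \<open>T\<close>, and the part of that radical inside \<open>S\<close> is contained
  in \<open>P\<close> (\<open>prime_radical_Int_prime_of_subring\<close>). So \<open>e\<close> becomes a central idempotent of the prime ring
  \<open>S / P\<close>, hence \<open>0\<close> or \<open>1\<close>, and \<open>S / P\<close> is already the image of \<open>R\<close>: we have \<open>S = R + P\<close> for every prime
  ideal \<open>P\<close> of \<open>S\<close> (\<open>generated_by_idempotents_cover_prime_factor\<close>). The first two assertions follow
  from this covering property alone.

  By the covering property, \<open>P \<inter> R\<close> is a prime ideal of \<open>R\<close> with \<open>R / (P \<inter> R) \<cong> S / P\<close>, and the ideals of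
  \<open>S\<close> above \<open>P\<close> correspond to those of \<open>R\<close> above \<open>P \<inter> R\<close>. Conversely every prime ideal \<open>J\<close> of \<open>R\<close> is of this
  form (\<open>prime_ideal_lying_over\<close>): a prime ideal \<open>P\<close> of \<open>S\<close> that is maximal with \<open>P \<inter> R \<subseteq> J\<close> contains \<open>J\<close>,
  because \<open>J + P\<close> is an ideal that contracts to \<open>J\<close>. Chains of primes therefore correspond, which gives
  the equality of dimensions. For the radicals, a special radical is the intersection of the ideals
  whose quotient lies in the special class (\<open>upper_radical_special_class\<close>). Apart from the whole ring
  these ideals are prime, and corresponding primes have isomorphic quotients.

  If \<open>S\<close> is von Neumann regular, it meets the prime radical of \<open>T\<close> only in \<open>0\<close>, so that the idempotents
  are central in \<open>S\<close>. Then each element of \<open>S\<close> agrees with elements of \<open>R\<close> on the pieces of a finite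
  decomposition of \<open>1\<close> into central elements. A quasi-inverse in \<open>S\<close> of an element \<open>a\<close> of \<open>R\<close> thus provides
  local quasi-inverses in \<open>R\<close>, and these can be glued: if \<open>u\<close> and \<open>v\<close> work locally, then \<open>u + v - u a v\<close> works
  wherever one of them does (\<open>von_neumann_regular_subring\<close>).
\<close>

section \<open>Rings without unity, their ideals and quotients\<close>

sublocale rng_ideal \<subseteq> abelian_subgroup I R
  by (intro abelian_subgroupI3 is_additive_subgroup abelian_group_axioms)

lemmas (in rng_ideal) I_add = additive_subgroup.a_closed[OF is_additive_subgroup]
  and I_zero = additive_subgroup.zero_closed[OF is_additive_subgroup]
  and I_minus = additive_subgroup.a_inv_closed[OF is_additive_subgroup]

sublocale ring \<subseteq> rng
  by unfold_locales (auto simp: m_assoc l_distr r_distr)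

sublocale ideal \<subseteq> rng_ideal
  by unfold_locales (auto simp: I_l_closed I_r_closed)

lemma (in ring) rng_ideal_iff_ideal: "rng_ideal I R \<longleftrightarrow> ideal I R"
proof
  assume "rng_ideal I R"
  then interpret rng_ideal I R .
  show "ideal I R"
    by (intro ideal.intro ideal_axioms.intro is_additive_subgroup ring_axioms
        rng_I_l_closed rng_I_r_closed)
next
  assume "ideal I R"
  then interpret ideal I R .
  show "rng_ideal I R" by (fact rng_ideal_axioms)
qed

lemma rng_idealI:
  fixes A (structure)
  assumes "rng A" "I \<subseteq> carrier A" "\<zero> \<in> I"
    and "\<And>x y. x \<in> I \<Longrightarrow> y \<in> I \<Longrightarrow> x \<oplus> y \<in> I"
    and "\<And>x. x \<in> I \<Longrightarrow> \<ominus> x \<in> I"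
    and "\<And>x a. x \<in> I \<Longrightarrow> a \<in> carrier A \<Longrightarrow> a \<otimes> x \<in> I"
    and "\<And>x a. x \<in> I \<Longrightarrow> a \<in> carrier A \<Longrightarrow> x \<otimes> a \<in> I"
  shows "rng_ideal I A"
proof -
  interpret rng A by fact
  have "additive_subgroup I A"
    using assms by (intro additive_subgroupI subgroup.intro) (auto simp: a_inv_def[symmetric])
  then show ?thesis
    using assms by (intro rng_ideal.intro rng_ideal_axioms.intro) auto
qed

lemma (in rng) rng_zero_mult [simp]:
  assumes "x \<in> carrier R"
  shows "\<zero> \<otimes> x = \<zero>" and "x \<otimes> \<zero> = \<zero>"
proof -
  have "\<zero> \<otimes> x \<oplus> \<zero> \<otimes> x = \<zero> \<otimes> x \<oplus> \<zero>" "x \<otimes> \<zero> \<oplus> x \<otimes> \<zero> = x \<otimes> \<zero> \<oplus> \<zero>"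
    using rng_l_distr[of \<zero> \<zero> x] rng_r_distr[of \<zero> \<zero> x] assms rng_m_closed by auto
  then show "\<zero> \<otimes> x = \<zero>" "x \<otimes> \<zero> = \<zero>"
    using assms rng_m_closed by (auto simp del: r_zero)
qed

lemma (in rng) rng_minus_mult:
  assumes "x \<in> carrier R" "y \<in> carrier R"
  shows "(\<ominus> x) \<otimes> y = \<ominus> (x \<otimes> y)" and "x \<otimes> (\<ominus> y) = \<ominus> (x \<otimes> y)"
proof -
  have "(\<ominus> x) \<otimes> y \<oplus> x \<otimes> y = (\<ominus> x \<oplus> x) \<otimes> y" "x \<otimes> (\<ominus> y) \<oplus> x \<otimes> y = x \<otimes> (\<ominus> y \<oplus> y)"
    using assms by (simp_all add: rng_l_distr rng_r_distr del: l_neg)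
  then have "(\<ominus> x) \<otimes> y \<oplus> x \<otimes> y = \<zero>" "x \<otimes> (\<ominus> y) \<oplus> x \<otimes> y = \<zero>"
    using assms by (simp_all add: l_neg)
  then show "(\<ominus> x) \<otimes> y = \<ominus> (x \<otimes> y)" and "x \<otimes> (\<ominus> y) = \<ominus> (x \<otimes> y)"
    using assms by (auto intro!: minus_equality[symmetric] simp: rng_m_closed)
qed

lemma rng_ideal_imp_rng:
  fixes A (structure)
  assumes "rng_ideal H A"
  shows "rng (A\<lparr>carrier := H\<rparr>)"
proof -
  interpret rng_ideal H A by fact
  have "abelian_group (A\<lparr>carrier := H\<rparr>)"
    by (rule abelian_groupI) (use a_Hcarr a_assoc a_comm l_neg in \<open>auto intro!: bexI[of _ "\<ominus> _"]\<close>)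
  moreover have "rng_axioms (A\<lparr>carrier := H\<rparr>)"
    by unfold_locales
      (use a_Hcarr rng_I_l_closed rng_m_assoc rng_l_distr rng_r_distr in auto)
  ultimately show ?thesis
    by (rule rng.intro)
qed

lemma rng_ideal_Int:
  fixes A (structure)
  assumes "rng_ideal I A" "rng_ideal J A"
  shows "rng_ideal (I \<inter> J) (A\<lparr>carrier := J\<rparr>)"
proof -
  interpret I: rng_ideal I A by fact
  interpret J: rng_ideal J A by fact
  interpret JR: rng "A\<lparr>carrier := J\<rparr>" using assms(2) by (rule rng_ideal_imp_rng)
  have inv: "\<ominus>\<^bsub>A\<lparr>carrier := J\<rparr>\<^esub> x = \<ominus> x" if "x \<in> J" for x
    using that by (intro JR.minus_equality) (auto simp: I.l_neg)
  show ?thesis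
    by (rule rng_idealI[OF JR.rng_axioms])
      (use inv I.rng_I_l_closed I.rng_I_r_closed J.rng_I_l_closed J.rng_I_r_closed in auto)
qed

definition rng_hom :: "('a, 'm) ring_scheme \<Rightarrow> ('b, 'n) ring_scheme \<Rightarrow> ('a \<Rightarrow> 'b) set" where
  "rng_hom A B = hom A B \<inter> hom (add_monoid A) (add_monoid B)"

lemma rng_homD:
  assumes "f \<in> rng_hom A B"
  shows "x \<in> carrier A \<Longrightarrow> f x \<in> carrier B"
    and "x \<in> carrier A \<Longrightarrow> y \<in> carrier A \<Longrightarrow> f (x \<otimes>\<^bsub>A\<^esub> y) = f x \<otimes>\<^bsub>B\<^esub> f y"
    and "x \<in> carrier A \<Longrightarrow> y \<in> carrier A \<Longrightarrow> f (x \<oplus>\<^bsub>A\<^esub> y) = f x \<oplus>\<^bsub>B\<^esub> f y"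
  using assms by (auto simp: rng_hom_def hom_def)

lemma rng_hom_zero_inv:
  assumes "rng A" "rng B" "f \<in> rng_hom A B"
  shows "f \<zero>\<^bsub>A\<^esub> = \<zero>\<^bsub>B\<^esub>" and "x \<in> carrier A \<Longrightarrow> f (\<ominus>\<^bsub>A\<^esub> x) = \<ominus>\<^bsub>B\<^esub> f x"
proof -
  interpret A: rng A by fact
  interpret B: rng B by fact
  interpret abelian_group_hom A B f
    using assms(3)
    by (intro abelian_group_homI A.abelian_group_axioms B.abelian_group_axioms
        group_hom.intro group_hom_axioms.intro A.a_group B.a_group) (auto simp: rng_hom_def)
  show "f \<zero>\<^bsub>A\<^esub> = \<zero>\<^bsub>B\<^esub>" and "x \<in> carrier A \<Longrightarrow> f (\<ominus>\<^bsub>A\<^esub> x) = \<ominus>\<^bsub>B\<^esub> f x"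
    by simp_all
qed

lemma rng_epimorphic_image:
  assumes "rng A" and f: "f \<in> rng_hom A B" "f ` carrier A = carrier B" "f \<zero>\<^bsub>A\<^esub> = \<zero>\<^bsub>B\<^esub>"
  shows "rng B"
proof -
  interpret A: rng A by fact
  note hom [simp] = rng_homD(2,3)[OF f(1), symmetric]
  have zero: "\<zero>\<^bsub>B\<^esub> \<in> f ` carrier A"
    using f(3) by (metis A.zero_closed imageI)
  have inv: "\<exists>y\<in>f ` carrier A. y \<oplus>\<^bsub>B\<^esub> x = \<zero>\<^bsub>B\<^esub>" if x: "x \<in> f ` carrier A" for x
  proof -
    obtain a where a: "a \<in> carrier A" "x = f a" using x by auto
    then have "f (\<ominus>\<^bsub>A\<^esub> a) \<oplus>\<^bsub>B\<^esub> x = \<zero>\<^bsub>B\<^esub>" using f(3) by (simp add: A.l_neg)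
    then show ?thesis using a by auto
  qed
  have "abelian_group B"
    by (rule abelian_groupI)
      (use inv zero in \<open>auto simp: f(2)[symmetric] f(3)[symmetric] A.a_assoc A.a_comm A.a_lcomm\<close>)
  moreover have "rng_axioms B"
    by unfold_locales
      (auto simp: f(2)[symmetric] A.rng_m_assoc A.rng_m_closed A.rng_l_distr A.rng_r_distr)
  ultimately show ?thesis
    by (rule rng.intro)
qed

text \<open>
  This form of the homomorphism theorem needs no kernel and no subtraction: two epimorphisms that
  identify the same pairs have isomorphic images. Subtraction is awkward here because the inverse
  of a ring structure with a restricted carrier is a different term from that of the full one.
\<close>

lemma rng_isomorphic_if_same_kernel:
  assumes "rng A"
    and f: "f \<in> rng_hom A B" "f ` carrier A = carrier B"
    and g: "g \<in> rng_hom A C" "g ` carrier A = carrier C"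
    and ker: "\<And>x y. x \<in> carrier A \<Longrightarrow> y \<in> carrier A \<Longrightarrow> f x = f y \<longleftrightarrow> g x = g y"
  shows "rng_isomorphic B C"
proof -
  interpret A: rng A by fact
  define h where "h b = g (inv_into (carrier A) f b)" for b
  have h [simp]: "h (f x) = g x" if "x \<in> carrier A" for x
  proof -
    have "f x \<in> f ` carrier A" using that by simp
    then have "inv_into (carrier A) f (f x) \<in> carrier A" "f (inv_into (carrier A) f (f x)) = f x"
      by (rule inv_into_into, rule f_inv_into_f)
    then show ?thesis unfolding h_def using ker that by blast
  qed
  note fs = rng_homD(2,3)[OF f(1), symmetric] and gs = rng_homD[OF g(1)]
  have "h \<in> hom B C" "h \<in> hom (add_monoid B) (add_monoid C)"
    by (auto simp: hom_def f(2)[symmetric] fs gs A.rng_m_closed)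
  moreover have "bij_betw h (carrier B) (carrier C)"
    unfolding bij_betw_def inj_on_def using ker by (force simp: f(2)[symmetric] g(2)[symmetric])
  ultimately show ?thesis
    unfolding rng_isomorphic_def by blast
qed

context rng_ideal
begin

lemma mem_coset_iff: "x \<in> I +> y \<longleftrightarrow> (\<exists>i\<in>I. x = i \<oplus> y)"
  by (auto simp: a_r_coset_def')

lemma coset_eq_iff:
  assumes "x \<in> carrier R" "y \<in> carrier R"
  shows "I +> x = I +> y \<longleftrightarrow> x \<in> I +> y"
  using assms a_repr_independence' a_rcos_self by metis

lemma coset_eq_zero_iff:
  assumes "x \<in> carrier R"
  shows "I +> x = I \<longleftrightarrow> x \<in> I"
  using coset_eq_iff[of x \<zero>] assms by (simp add: a_coset_add_zero a_subset)

lemma coset_mult: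
  assumes x: "x \<in> carrier R" and y: "y \<in> carrier R"
  shows "rcoset_mult R I (I +> x) (I +> y) = I +> (x \<otimes> y)"
proof -
  have *: "I +> (x' \<otimes> y') = I +> (x \<otimes> y)" if x': "x' \<in> I +> x" and y': "y' \<in> I +> y" for x' y'
  proof -
    obtain i j where ij: "i \<in> I" "j \<in> I" "x' = i \<oplus> x" "y' = j \<oplus> y"
      using x' y' by (auto simp: mem_coset_iff)
    have c: "i \<in> carrier R" "j \<in> carrier R" using ij by auto
    have "x' \<otimes> y' = (i \<otimes> j \<oplus> x \<otimes> j \<oplus> i \<otimes> y) \<oplus> x \<otimes> y"
      using x y c ij(3,4) by (simp add: rng_l_distr rng_r_distr rng_m_closed a_assoc)
    moreover have "i \<otimes> j \<oplus> x \<otimes> j \<oplus> i \<otimes> y \<in> I"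
      using rng_I_l_closed[OF ij(2)] rng_I_r_closed[OF ij(1)] x y c
      by (auto intro!: I_add)
    ultimately show ?thesis
      using x y c ij(3,4) by (subst coset_eq_iff) (auto simp: mem_coset_iff rng_m_closed)
  qed
  show ?thesis
    unfolding rcoset_mult_def using * a_rcos_self[OF x] a_rcos_self[OF y] by blast
qed

lemma quotient_map_rng_hom: "(+>) I \<in> rng_hom R (R Quot I)"
  unfolding rng_hom_def hom_def
  by (auto simp: FactRing_def coset_mult a_rcos_sum a_rcosetsI[OF a_subset])

lemma quotient_map_surj: "(+>) I ` carrier R = carrier (R Quot I)"
  by (auto simp: FactRing_def A_RCOSETS_def')

lemma quotient_rng: "rng (R Quot I)"
  by (rule rng_epimorphic_image[OF rng_axioms quotient_map_rng_hom quotient_map_surj])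
    (simp add: FactRing_def a_coset_add_zero a_subset)

lemma quotient_zero: "\<zero>\<^bsub>R Quot I\<^esub> = I"
  by (simp add: FactRing_def)

end

lemma rng_ideal_image:
  assumes "rng A" "rng B" and f: "f \<in> rng_hom A B" "f ` carrier A = carrier B"
    and J: "rng_ideal J A"
  shows "rng_ideal (f ` J) B"
proof -
  interpret A: rng A by fact
  interpret J: rng_ideal J A by fact
  note fs = rng_homD[OF f(1)] and f0 = rng_hom_zero_inv[OF assms(1,2) f(1)]
  show ?thesis
  proof (rule rng_idealI[OF assms(2)])
    show "\<zero>\<^bsub>B\<^esub> \<in> f ` J" using f0(1) by (metis J.I_zero imageI)
    show "f ` J \<subseteq> carrier B" using fs(1) by auto
  next
    fix x y assume "x \<in> f ` J" "y \<in> f ` J"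
    then show "x \<oplus>\<^bsub>B\<^esub> y \<in> f ` J" by (auto simp: fs(3)[symmetric])
  next
    fix x assume "x \<in> f ` J"
    then show "\<ominus>\<^bsub>B\<^esub> x \<in> f ` J" by (auto simp: f0(2)[symmetric])
  next
    fix x a assume x: "x \<in> f ` J" and a: "a \<in> carrier B"
    then obtain j b where "j \<in> J" "x = f j" "b \<in> carrier A" "a = f b"
      by (auto simp: f(2)[symmetric])
    then show "a \<otimes>\<^bsub>B\<^esub> x \<in> f ` J" "x \<otimes>\<^bsub>B\<^esub> a \<in> f ` J"
      by (auto simp: fs(2)[symmetric] J.rng_I_l_closed J.rng_I_r_closed)
  qed
qed

text \<open>
  Both maps in play, \<open>j \<mapsto> I + j\<close> and \<open>j \<mapsto> (I \<inter> J) + j\<close>, are defined on \<open>J\<close> and identify the same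
  pairs. The image of \<open>J\<close> in \<open>A / I\<close> stands for \<open>(I + J) / I\<close>.
\<close>

lemma second_isomorphism_rng:
  assumes "rng_ideal I A" "rng_ideal J A"
  shows "rng_isomorphic ((A Quot I)\<lparr>carrier := (a_r_coset A I) ` J\<rparr>)
           (A\<lparr>carrier := J\<rparr> Quot (I \<inter> J))"
    and "rng_isomorphic (A\<lparr>carrier := J\<rparr> Quot (I \<inter> J))
           ((A Quot I)\<lparr>carrier := (a_r_coset A I) ` J\<rparr>)"
proof -
  interpret I: rng_ideal I A by fact
  interpret J: rng_ideal J A by fact
  interpret K: rng_ideal "I \<inter> J" "A\<lparr>carrier := J\<rparr>"
    using assms by (rule rng_ideal_Int)
  have f: "a_r_coset A I \<in> rng_hom (A\<lparr>carrier := J\<rparr>) ((A Quot I)\<lparr>carrier := (a_r_coset A I) ` J\<rparr>)"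
    using I.quotient_map_rng_hom by (auto simp: rng_hom_def hom_def)
  have ker: "a_r_coset A I x = a_r_coset A I y \<longleftrightarrow>
      a_r_coset (A\<lparr>carrier := J\<rparr>) (I \<inter> J) x = a_r_coset (A\<lparr>carrier := J\<rparr>) (I \<inter> J) y"
    if "x \<in> J" "y \<in> J" for x y
  proof -
    have "i \<in> J" if "i \<in> I" "i \<oplus>\<^bsub>A\<^esub> y \<in> J" for i
    proof -
      have "i = (i \<oplus>\<^bsub>A\<^esub> y) \<oplus>\<^bsub>A\<^esub> \<ominus>\<^bsub>A\<^esub> y"
        using that \<open>y \<in> J\<close> by (simp add: I.a_assoc I.r_neg)
      then show ?thesis using that \<open>y \<in> J\<close> by (metis J.I_add J.I_minus)
    qed
    then show ?thesis
      using that by (auto simp: I.coset_eq_iff K.coset_eq_iff I.mem_coset_iff K.mem_coset_iff)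
  qed
  show "rng_isomorphic ((A Quot I)\<lparr>carrier := (a_r_coset A I) ` J\<rparr>)
           (A\<lparr>carrier := J\<rparr> Quot (I \<inter> J))"
    by (rule rng_isomorphic_if_same_kernel[OF K.rng_axioms f _ K.quotient_map_rng_hom K.quotient_map_surj])
      (use ker in auto)
  show "rng_isomorphic (A\<lparr>carrier := J\<rparr> Quot (I \<inter> J))
           ((A Quot I)\<lparr>carrier := (a_r_coset A I) ` J\<rparr>)"
    by (rule rng_isomorphic_if_same_kernel[OF K.rng_axioms K.quotient_map_rng_hom K.quotient_map_surj f])
      (use ker in auto)
qed

section \<open>Special radicals as intersections\<close>

lemma prime_quotient_rng_ideals:
  assumes "rng_ideal I A" "prime_rng (A Quot I)"
    and "rng_ideal J A" "rng_ideal K A" and JK: "\<And>x y. x \<in> J \<Longrightarrow> y \<in> K \<Longrightarrow> x \<otimes>\<^bsub>A\<^esub> y \<in> I"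
  shows "J \<subseteq> I \<or> K \<subseteq> I"
proof -
  interpret I: rng_ideal I A by fact
  interpret J: rng_ideal J A by fact
  interpret K: rng_ideal K A by fact
  interpret Q: rng "A Quot I" by (rule I.quotient_rng)
  let ?p = "a_r_coset A I"
  have img: "rng_ideal (?p ` J) (A Quot I)" "rng_ideal (?p ` K) (A Quot I)"
    by (rule rng_ideal_image[OF I.rng_axioms I.quotient_rng I.quotient_map_rng_hom I.quotient_map_surj];
        fact)+
  have "(?p ` J) \<cdot>\<^bsub>A Quot I\<^esub> (?p ` K) \<subseteq> {\<zero>\<^bsub>A Quot I\<^esub>}"
  proof
    fix z assume "z \<in> (?p ` J) \<cdot>\<^bsub>A Quot I\<^esub> (?p ` K)"
    then show "z \<in> {\<zero>\<^bsub>A Quot I\<^esub>}"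
    proof induction
      case (prod i j)
      then obtain x y where xy: "x \<in> J" "y \<in> K" "i = ?p x" "j = ?p y" by auto
      then have "i \<otimes>\<^bsub>A Quot I\<^esub> j = ?p (x \<otimes>\<^bsub>A\<^esub> y)"
        by (simp add: FactRing_def I.coset_mult)
      then show ?case
        using JK[OF xy(1,2)] by (simp add: I.quotient_zero I.coset_eq_zero_iff)
    qed simp
  qed
  then have "?p ` J = {I} \<or> ?p ` K = {I}"
    using assms(2) img unfolding prime_rng_def I.quotient_zero by blast
  then show ?thesis
    using I.coset_eq_zero_iff by (metis J.a_Hcarr K.a_Hcarr imageI singletonD subsetI)
qed

text \<open>
  Andrunakievich's lemma, in the case that is needed: being an ideal is transitive once the inner
  quotient \<open>H / K\<close> is prime. The elements \<open>h\<close> of \<open>H\<close> with \<open>H h \<subseteq> K\<close> form an ideal of \<open>H\<close> whose square is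
  contained in \<open>K\<close>, hence they lie in \<open>K\<close>; likewise on the other side. For \<open>k\<close> in \<open>K\<close> and \<open>a\<close> in \<open>A\<close> the
  inclusion \<open>H (a k) = (H a) k \<subseteq> K\<close> then gives \<open>a k \<in> K\<close>.
\<close>

lemma ideal_of_ideal_prime_quotient:
  assumes H: "rng_ideal H A" and K: "rng_ideal K (A\<lparr>carrier := H\<rparr>)"
    and prime: "prime_rng (A\<lparr>carrier := H\<rparr> Quot K)"
  shows "\<And>h. h \<in> H \<Longrightarrow> (\<And>x. x \<in> H \<Longrightarrow> x \<otimes>\<^bsub>A\<^esub> h \<in> K) \<Longrightarrow> h \<in> K"
    and "rng_ideal K A"
proof -
  interpret H: rng_ideal H A by fact
  interpret K: rng_ideal K "A\<lparr>carrier := H\<rparr>" by fact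
  have KH: "k \<in> H" if "k \<in> K" for k using K.a_Hcarr that by simp
  have inv: "\<ominus>\<^bsub>A\<lparr>carrier := H\<rparr>\<^esub> x = \<ominus>\<^bsub>A\<^esub> x" if "x \<in> H" for x
    using that by (intro K.minus_equality) (auto simp: H.l_neg)
  have Kinv: "\<ominus>\<^bsub>A\<^esub> x \<in> K" if "x \<in> K" for x
    using K.I_minus[OF that] inv[OF KH[OF that]] by simp
  have Kadd: "x \<oplus>\<^bsub>A\<^esub> y \<in> K" if "x \<in> K" "y \<in> K" for x y
    using K.I_add[OF that] by simp
  have K0: "\<zero>\<^bsub>A\<^esub> \<in> K" using K.I_zero by simp
  note Kl = K.rng_I_l_closed[simplified] and Kr = K.rng_I_r_closed[simplified]
  have l: "h \<in> K" if h: "h \<in> H" "\<And>x. x \<in> H \<Longrightarrow> x \<otimes>\<^bsub>A\<^esub> h \<in> K" for h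
  proof -
    let ?D = "{h \<in> H. \<forall>x\<in>H. x \<otimes>\<^bsub>A\<^esub> h \<in> K}"
    have "rng_ideal ?D (A\<lparr>carrier := H\<rparr>)"
    proof (rule rng_idealI[OF K.rng_axioms])
      fix x a assume x: "x \<in> ?D" and a: "a \<in> carrier (A\<lparr>carrier := H\<rparr>)"
      have "y \<otimes>\<^bsub>A\<^esub> (a \<otimes>\<^bsub>A\<^esub> x) \<in> K" "y \<otimes>\<^bsub>A\<^esub> (x \<otimes>\<^bsub>A\<^esub> a) \<in> K" if y: "y \<in> H" for y
      proof -
        have "y \<otimes>\<^bsub>A\<^esub> (a \<otimes>\<^bsub>A\<^esub> x) = (y \<otimes>\<^bsub>A\<^esub> a) \<otimes>\<^bsub>A\<^esub> x" "y \<otimes>\<^bsub>A\<^esub> (x \<otimes>\<^bsub>A\<^esub> a) = (y \<otimes>\<^bsub>A\<^esub> x) \<otimes>\<^bsub>A\<^esub> a"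
          using x y a H.a_Hcarr by (auto simp: H.rng_m_assoc)
        moreover have "y \<otimes>\<^bsub>A\<^esub> a \<in> H"
          using y a H.rng_I_l_closed by simp
        ultimately show "y \<otimes>\<^bsub>A\<^esub> (a \<otimes>\<^bsub>A\<^esub> x) \<in> K" "y \<otimes>\<^bsub>A\<^esub> (x \<otimes>\<^bsub>A\<^esub> a) \<in> K"
          using x y a by (simp_all add: Kr)
      qed
      then show "a \<otimes>\<^bsub>A\<lparr>carrier := H\<rparr>\<^esub> x \<in> ?D" "x \<otimes>\<^bsub>A\<lparr>carrier := H\<rparr>\<^esub> a \<in> ?D"
        using x a H.rng_I_l_closed H.a_Hcarr by auto
    qed (auto simp: H.rng_r_distr H.rng_minus_mult K0 Kadd Kinv inv)
    from prime_quotient_rng_ideals[OF K prime this this]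
    have "?D \<subseteq> K" by auto
    with h show ?thesis by auto
  qed
  have r: "h \<in> K" if h: "h \<in> H" "\<And>x. x \<in> H \<Longrightarrow> h \<otimes>\<^bsub>A\<^esub> x \<in> K" for h
  proof -
    let ?D = "{h \<in> H. \<forall>x\<in>H. h \<otimes>\<^bsub>A\<^esub> x \<in> K}"
    have "rng_ideal ?D (A\<lparr>carrier := H\<rparr>)"
    proof (rule rng_idealI[OF K.rng_axioms])
      fix x a assume x: "x \<in> ?D" and a: "a \<in> carrier (A\<lparr>carrier := H\<rparr>)"
      have "(a \<otimes>\<^bsub>A\<^esub> x) \<otimes>\<^bsub>A\<^esub> y \<in> K" "(x \<otimes>\<^bsub>A\<^esub> a) \<otimes>\<^bsub>A\<^esub> y \<in> K" if y: "y \<in> H" for y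
      proof -
        have "(a \<otimes>\<^bsub>A\<^esub> x) \<otimes>\<^bsub>A\<^esub> y = a \<otimes>\<^bsub>A\<^esub> (x \<otimes>\<^bsub>A\<^esub> y)" "(x \<otimes>\<^bsub>A\<^esub> a) \<otimes>\<^bsub>A\<^esub> y = x \<otimes>\<^bsub>A\<^esub> (a \<otimes>\<^bsub>A\<^esub> y)"
          using x y a H.a_Hcarr by (auto simp: H.rng_m_assoc)
        moreover have "a \<otimes>\<^bsub>A\<^esub> y \<in> H"
          using y a H.rng_I_l_closed by simp
        ultimately show "(a \<otimes>\<^bsub>A\<^esub> x) \<otimes>\<^bsub>A\<^esub> y \<in> K" "(x \<otimes>\<^bsub>A\<^esub> a) \<otimes>\<^bsub>A\<^esub> y \<in> K"
          using x y a by (simp_all add: Kl)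
      qed
      then show "a \<otimes>\<^bsub>A\<lparr>carrier := H\<rparr>\<^esub> x \<in> ?D" "x \<otimes>\<^bsub>A\<lparr>carrier := H\<rparr>\<^esub> a \<in> ?D"
        using x a H.rng_I_l_closed H.a_Hcarr by auto
    qed (auto simp: H.rng_l_distr H.rng_minus_mult K0 Kadd Kinv inv)
    from prime_quotient_rng_ideals[OF K prime this this]
    have "?D \<subseteq> K" by auto
    with h show ?thesis by auto
  qed
  show "\<And>h. h \<in> H \<Longrightarrow> (\<And>x. x \<in> H \<Longrightarrow> x \<otimes>\<^bsub>A\<^esub> h \<in> K) \<Longrightarrow> h \<in> K" by (fact l)
  show "rng_ideal K A"
  proof (rule rng_idealI[OF H.rng_axioms _ K0 Kadd Kinv])
    fix k a assume k: "k \<in> K" and a: "a \<in> carrier A"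
    have c: "k \<in> carrier A" "k \<in> H" using KH k by auto
    show "a \<otimes>\<^bsub>A\<^esub> k \<in> K"
    proof (rule l)
      fix x assume x: "x \<in> H"
      then have "x \<otimes>\<^bsub>A\<^esub> (a \<otimes>\<^bsub>A\<^esub> k) = (x \<otimes>\<^bsub>A\<^esub> a) \<otimes>\<^bsub>A\<^esub> k" using a c by (simp add: H.rng_m_assoc)
      then show "x \<otimes>\<^bsub>A\<^esub> (a \<otimes>\<^bsub>A\<^esub> k) \<in> K" using x a k by (simp add: Kl H.rng_I_r_closed)
    qed (use a c in \<open>simp add: H.rng_I_l_closed\<close>)
    show "k \<otimes>\<^bsub>A\<^esub> a \<in> K"
    proof (rule r)
      fix x assume x: "x \<in> H"
      then have "(k \<otimes>\<^bsub>A\<^esub> a) \<otimes>\<^bsub>A\<^esub> x = k \<otimes>\<^bsub>A\<^esub> (a \<otimes>\<^bsub>A\<^esub> x)" using a c by (simp add: H.rng_m_assoc)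
      then show "(k \<otimes>\<^bsub>A\<^esub> a) \<otimes>\<^bsub>A\<^esub> x \<in> K" using x a k by (simp add: Kr H.rng_I_l_closed)
    qed (use a c in \<open>simp add: H.rng_I_r_closed\<close>)
  qed (use KH in auto)
qed

text \<open>
  A prime quotient \<open>H / K\<close> of an ideal \<open>H\<close> is the trace of a quotient of the whole ring. The ideal
  \<open>L = {a. H a \<subseteq> K}\<close> meets \<open>H\<close> in \<open>K\<close>, so the image of \<open>H\<close> in \<open>A / L\<close> is isomorphic to \<open>H / K\<close>. That image is an
  essential ideal: an ideal \<open>J\<close> of \<open>A / L\<close> that meets it trivially is annihilated by it from the left,
  and \<open>L\<close> was chosen so that only zero is.
\<close>

lemma special_class_extension:
  fixes M :: "'a set ring set" and A :: "('a, 'm) ring_scheme"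
  assumes M: "special_class M" and H: "rng_ideal H A" and K: "rng_ideal K (A\<lparr>carrier := H\<rparr>)"
    and HK: "A\<lparr>carrier := H\<rparr> Quot K \<in> M"
  shows "\<exists>L. rng_ideal L A \<and> A Quot L \<in> M \<and> L \<inter> H = K"
proof -
  have prime: "prime_rng (A\<lparr>carrier := H\<rparr> Quot K)"
    using M HK unfolding special_class_def by blast
  interpret H: rng_ideal H A by fact
  interpret KA: rng_ideal K A by (rule ideal_of_ideal_prime_quotient(2)[OF H K prime])
  note KD = ideal_of_ideal_prime_quotient(1)[OF H K prime]
  have KH: "K \<subseteq> H"
    using rng_ideal.axioms(1)[OF K] additive_subgroup.a_subset by fastforce
  define L where "L = {a \<in> carrier A. \<forall>x\<in>H. x \<otimes>\<^bsub>A\<^esub> a \<in> K}"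
  have L: "rng_ideal L A"
  proof (rule rng_idealI[OF H.rng_axioms])
    fix x a assume x: "x \<in> L" and a: "a \<in> carrier A"
    have "y \<otimes>\<^bsub>A\<^esub> (a \<otimes>\<^bsub>A\<^esub> x) \<in> K" "y \<otimes>\<^bsub>A\<^esub> (x \<otimes>\<^bsub>A\<^esub> a) \<in> K" if y: "y \<in> H" for y
    proof -
      have "y \<otimes>\<^bsub>A\<^esub> (a \<otimes>\<^bsub>A\<^esub> x) = (y \<otimes>\<^bsub>A\<^esub> a) \<otimes>\<^bsub>A\<^esub> x" "y \<otimes>\<^bsub>A\<^esub> (x \<otimes>\<^bsub>A\<^esub> a) = (y \<otimes>\<^bsub>A\<^esub> x) \<otimes>\<^bsub>A\<^esub> a"
        using x y a by (auto simp: H.rng_m_assoc L_def)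
      then show "y \<otimes>\<^bsub>A\<^esub> (a \<otimes>\<^bsub>A\<^esub> x) \<in> K" "y \<otimes>\<^bsub>A\<^esub> (x \<otimes>\<^bsub>A\<^esub> a) \<in> K"
        using x y a by (auto simp: L_def intro: KA.rng_I_r_closed H.rng_I_r_closed)
    qed
    then show "a \<otimes>\<^bsub>A\<^esub> x \<in> L" "x \<otimes>\<^bsub>A\<^esub> a \<in> L"
      using x a by (auto simp: L_def H.rng_m_closed)
  qed (auto simp: L_def H.rng_r_distr H.rng_minus_mult)
  interpret L: rng_ideal L A by (fact L)
  have LH: "L \<inter> H = K"
  proof
    show "L \<inter> H \<subseteq> K"
      using KD unfolding L_def by blast
    show "K \<subseteq> L \<inter> H"
      using KH KA.rng_I_l_closed KA.a_Hcarr H.a_Hcarr unfolding L_def by blast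
  qed
  let ?p = "a_r_coset A L"
  have img: "rng_ideal (?p ` H) (A Quot L)"
    by (rule rng_ideal_image[OF H.rng_axioms L.quotient_rng L.quotient_map_rng_hom L.quotient_map_surj H])
  have "rng_isomorphic (A\<lparr>carrier := H\<rparr> Quot K) ((A Quot L)\<lparr>carrier := ?p ` H\<rparr>)"
    using second_isomorphism_rng(2)[OF L H] by (simp add: LH)
  then have inM: "(A Quot L)\<lparr>carrier := ?p ` H\<rparr> \<in> M"
    using M HK rng_ideal_imp_rng[OF img] unfolding special_class_def by blast
  have "J = {\<zero>\<^bsub>A Quot L\<^esub>}"
    if J: "rng_ideal J (A Quot L)" and J0: "?p ` H \<inter> J = {\<zero>\<^bsub>A Quot L\<^esub>}" for J
  proof -
    interpret J: rng_ideal J "A Quot L" by fact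
    have "j = L" if j: "j \<in> J" for j
    proof -
      obtain a where a: "a \<in> carrier A" "j = ?p a"
        using J.a_Hcarr[OF j] by (auto simp: L.quotient_map_surj[symmetric])
      have "x \<otimes>\<^bsub>A\<^esub> a \<in> K" if x: "x \<in> H" for x
      proof -
        have xa: "x \<otimes>\<^bsub>A\<^esub> a \<in> H" using x a by (simp add: H.rng_I_r_closed)
        have "?p (x \<otimes>\<^bsub>A\<^esub> a) = ?p x \<otimes>\<^bsub>A Quot L\<^esub> j"
          using rng_homD(2)[OF L.quotient_map_rng_hom] x a by simp
        also have "\<dots> \<in> J"
          using rng_homD(1)[OF L.quotient_map_rng_hom] x j by (simp add: J.rng_I_l_closed)
        finally have "?p (x \<otimes>\<^bsub>A\<^esub> a) = L"
          using xa J0 by (auto simp: L.quotient_zero)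
        then show ?thesis
          using xa LH by (auto simp: L.coset_eq_zero_iff)
      qed
      then have "a \<in> L"
        using a(1) unfolding L_def by blast
      then show ?thesis
        using a by (simp add: L.coset_eq_zero_iff)
    qed
    then show ?thesis
      using J.I_zero unfolding L.quotient_zero by blast
  qed
  then have "essential_ideal (?p ` H) (A Quot L)"
    using img unfolding essential_ideal_def by blast
  then have "A Quot L \<in> M"
    using M inM L.quotient_rng unfolding special_class_def by blast
  then show ?thesis
    using L LH by blast
qed

text \<open>
  The description of a special radical as an intersection. An ideal \<open>J\<close> in the radical class is
  contained in each \<open>I\<close> of the intersection, because \<open>J / (I \<inter> J)\<close> is isomorphic to an ideal of \<open>A / I\<close>
  and the class is hereditary. Conversely the intersection \<open>H\<close> is itself in the radical class: a
  quotient \<open>H / K\<close> in \<open>M\<close> comes from an ideal \<open>L\<close> as in the preceding lemma, and \<open>H \<subseteq> L\<close> by the choice of \<open>H\<close>,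
  so \<open>K = L \<inter> H = H\<close>.
\<close>

theorem upper_radical_special_class:
  fixes M :: "'a set ring set" and A :: "('a, 'm) ring_scheme"
  assumes M: "special_class M" and "rng A"
  shows "upper_radical M A = {x \<in> carrier A. \<forall>I. rng_ideal I A \<longrightarrow> A Quot I \<in> M \<longrightarrow> x \<in> I}"
proof -
  define H where "H = {x \<in> carrier A. \<forall>I. rng_ideal I A \<longrightarrow> A Quot I \<in> M \<longrightarrow> x \<in> I}"
  interpret A: rng A by fact
  have H: "rng_ideal H A"
  proof (rule rng_idealI[OF assms(2)])
    fix x assume "x \<in> H"
    then show "\<ominus>\<^bsub>A\<^esub> x \<in> H"
      by (auto simp: H_def intro: rng_ideal.I_minus)
  next
    fix x y assume "x \<in> H" "y \<in> H"
    then show "x \<oplus>\<^bsub>A\<^esub> y \<in> H"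
      by (auto simp: H_def intro: rng_ideal.I_add)
  next
    show "\<zero>\<^bsub>A\<^esub> \<in> H"
      by (auto simp: H_def intro: rng_ideal.I_zero)
  qed (auto simp: H_def intro: rng_ideal.rng_I_l_closed rng_ideal.rng_I_r_closed A.rng_m_closed)
  interpret H: rng_ideal H A by (fact H)
  have le: "upper_radical M A \<subseteq> H"
    unfolding upper_radical_def
  proof (rule A.add.generate_subgroup_incl)
    show "subgroup H (add_monoid A)" by (fact H.a_subgroup)
    show "\<Union>{I. rng_ideal I A \<and> upper_radical_class M (A\<lparr>carrier := I\<rparr>)} \<subseteq> H"
    proof (rule Union_least)
      fix J assume "J \<in> {I. rng_ideal I A \<and> upper_radical_class M (A\<lparr>carrier := I\<rparr>)}"
      then have J: "rng_ideal J A" and rad: "upper_radical_class M (A\<lparr>carrier := J\<rparr>)"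
        by auto
      interpret J: rng_ideal J A by fact
      have "J \<subseteq> I" if I: "rng_ideal I A" and IM: "A Quot I \<in> M" for I
      proof -
        interpret I: rng_ideal I A by fact
        interpret IJ: rng_ideal "I \<inter> J" "A\<lparr>carrier := J\<rparr>" using I J by (rule rng_ideal_Int)
        have "rng_ideal (a_r_coset A I ` J) (A Quot I)"
          by (rule rng_ideal_image[OF assms(2) I.quotient_rng I.quotient_map_rng_hom I.quotient_map_surj J])
        then have "(A Quot I)\<lparr>carrier := a_r_coset A I ` J\<rparr> \<in> M"
          using M IM unfolding special_class_def by blast
        then have "A\<lparr>carrier := J\<rparr> Quot (I \<inter> J) \<in> M"
          using M IJ.quotient_rng second_isomorphism_rng(1)[OF I J] unfolding special_class_def by blast
        then have "I \<inter> J = J"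
          using rad IJ.rng_ideal_axioms unfolding upper_radical_class_def by auto
        then show ?thesis by auto
      qed
      then show "J \<subseteq> H" using J.a_subset unfolding H_def by blast
    qed
  qed
  have "upper_radical_class M (A\<lparr>carrier := H\<rparr>)"
    unfolding upper_radical_class_def
  proof (intro conjI allI impI rng_ideal_imp_rng[OF H])
    fix K assume "rng_ideal K (A\<lparr>carrier := H\<rparr>)" "A\<lparr>carrier := H\<rparr> Quot K \<in> M"
    from special_class_extension[OF M H this]
    obtain L where L: "rng_ideal L A" "A Quot L \<in> M" "L \<inter> H = K" by blast
    then have "H \<subseteq> L" unfolding H_def by blast
    then show "K = carrier (A\<lparr>carrier := H\<rparr>)" using L(3) by auto
  qed
  then have "H \<subseteq> upper_radical M A"
    using H unfolding upper_radical_def by (blast intro: generate.incl)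
  with le show ?thesis unfolding H_def by (rule equalityI)
qed

section \<open>Prime ideals and m-systems\<close>

lemma (in ring) idealI_elementwise:
  assumes "I \<subseteq> carrier R" "\<zero> \<in> I"
    and "\<And>x y. x \<in> I \<Longrightarrow> y \<in> I \<Longrightarrow> x \<oplus> y \<in> I"
    and "\<And>x a. x \<in> I \<Longrightarrow> a \<in> carrier R \<Longrightarrow> a \<otimes> x \<in> I"
    and "\<And>x a. x \<in> I \<Longrightarrow> a \<in> carrier R \<Longrightarrow> x \<otimes> a \<in> I"
  shows "ideal I R"
proof -
  have "\<ominus> x \<in> I" if "x \<in> I" for x
    using assms(4)[OF that, of "\<ominus> \<one>"] assms(1) that by (auto simp: l_minus)
  then show ?thesis
    using assms unfolding rng_ideal_iff_ideal[symmetric]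
    by (intro rng_idealI[OF rng_axioms]) auto
qed

text \<open>
  If \<open>x A y \<subseteq> P\<close>, the set \<open>L\<close> of all \<open>a\<close> with \<open>a A y \<subseteq> P\<close> is an ideal that contains \<open>x\<close>, and the set of all \<open>c\<close>
  with \<open>L A c \<subseteq> P\<close> is an ideal that contains \<open>y\<close>. Their product lies in \<open>P\<close>. This replaces the principal
  ideals of \<open>x\<close> and \<open>y\<close> and the finite sums in their description.
\<close>

lemma (in ring) prime_ideal_iff_elementwise:
  assumes "ideal P R"
  shows "prime_ideal P R \<longleftrightarrow> P \<noteq> carrier R \<and>
    (\<forall>x\<in>carrier R. \<forall>y\<in>carrier R. (\<forall>s\<in>carrier R. x \<otimes> s \<otimes> y \<in> P) \<longrightarrow> x \<in> P \<or> y \<in> P)"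
    (is "_ \<longleftrightarrow> _ \<and> ?elem")
proof -
  interpret P: ideal P R by fact
  have "?elem" if prime: "prime_ideal P R"
  proof (intro ballI impI)
    fix x y assume x: "x \<in> carrier R" and y: "y \<in> carrier R"
      and xy: "\<forall>s\<in>carrier R. x \<otimes> s \<otimes> y \<in> P"
    define L where "L = {a \<in> carrier R. \<forall>s\<in>carrier R. a \<otimes> s \<otimes> y \<in> P}"
    define N where "N = {c \<in> carrier R. \<forall>a\<in>L. \<forall>s\<in>carrier R. a \<otimes> s \<otimes> c \<in> P}"
    have L: "ideal L R"
    proof (rule idealI_elementwise)
      fix a b assume a: "a \<in> L" and b: "b \<in> carrier R"
      then have "b \<otimes> (a \<otimes> s \<otimes> y) \<in> P" "a \<otimes> (b \<otimes> s) \<otimes> y \<in> P" if "s \<in> carrier R" for s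
        using that by (auto simp: L_def P.I_l_closed)
      then show "b \<otimes> a \<in> L" "a \<otimes> b \<in> L"
        using a b y by (auto simp: L_def m_assoc)
    qed (use y in \<open>auto simp: L_def l_distr P.I_zero P.I_add\<close>)
    interpret L: ideal L R by (fact L)
    have N: "ideal N R"
    proof (rule idealI_elementwise)
      fix c b assume c: "c \<in> N" and b: "b \<in> carrier R"
      then have "(a \<otimes> s \<otimes> c) \<otimes> b \<in> P" "a \<otimes> (s \<otimes> b) \<otimes> c \<in> P"
        if "a \<in> L" "s \<in> carrier R" for a s
        using that by (auto simp: N_def P.I_r_closed)
      then show "b \<otimes> c \<in> N" "c \<otimes> b \<in> N"
        using b c L.a_subset by (auto simp: N_def m_assoc subset_iff)
    qed (use L.a_subset in \<open>auto simp: N_def r_distr subset_iff P.I_zero P.I_add\<close>)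
    have "L \<cdot> N \<subseteq> P"
    proof
      fix z assume "z \<in> L \<cdot> N"
      then show "z \<in> P"
      proof induction
        case (prod i j)
        then have "i \<otimes> \<one> \<otimes> j \<in> P" unfolding N_def by blast
        then show ?case using prod by simp
      qed (rule P.I_add)
    qed
    then have "L \<subseteq> P \<or> N \<subseteq> P"
      using prime L N unfolding prime_ideal_def by blast
    moreover have "x \<in> L" "y \<in> N"
      using x y xy unfolding L_def N_def by blast+
    ultimately show "x \<in> P \<or> y \<in> P" by blast
  qed
  moreover have "prime_ideal P R" if "P \<noteq> carrier R" and elem: ?elem
    unfolding prime_ideal_def
  proof (intro conjI allI impI assms that(1))
    fix I J assume I: "ideal I R" and J: "ideal J R" and IJ: "I \<cdot> J \<subseteq> P"
    interpret I: ideal I R by fact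
    interpret J: ideal J R by fact
    show "I \<subseteq> P \<or> J \<subseteq> P"
    proof (rule ccontr)
      assume "\<not> ?thesis"
      then obtain x y where xy: "x \<in> I" "x \<notin> P" "y \<in> J" "y \<notin> P" by blast
      have "x \<otimes> s \<otimes> y \<in> P" if "s \<in> carrier R" for s
        using ideal_prod.prod[OF I.I_r_closed[OF xy(1) that] xy(3), of R] IJ by blast
      then show False using elem xy I.a_Hcarr[OF xy(1)] J.a_Hcarr[OF xy(3)] by blast
    qed
  qed
  ultimately show ?thesis
    unfolding prime_ideal_def by blast
qed

text \<open>
  The noncommutative counterpart of avoiding a multiplicative set. Zorn's lemma gives \<open>P\<close>; two ideals
  that are not contained in \<open>P\<close> both meet \<open>Y\<close> after adding \<open>P\<close>, and if their product were contained in
  \<open>P\<close>, so would be some \<open>x s y\<close> in \<open>Y\<close>. The maximality is part of the conclusion because lying over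
  below depends on it.
\<close>

lemma (in ring) maximal_ideal_avoiding_m_system:
  assumes I: "ideal I R" "I \<inter> Y = {}" and Y: "Y \<noteq> {}" "Y \<subseteq> carrier R"
    and m: "\<And>x y. x \<in> Y \<Longrightarrow> y \<in> Y \<Longrightarrow> \<exists>s\<in>carrier R. x \<otimes> s \<otimes> y \<in> Y"
  obtains P where "prime_ideal P R" "I \<subseteq> P" "P \<inter> Y = {}"
    "\<And>K. ideal K R \<Longrightarrow> P \<subseteq> K \<Longrightarrow> K \<inter> Y = {} \<Longrightarrow> K = P"
proof -
  let ?F = "{K. ideal K R \<and> I \<subseteq> K \<and> K \<inter> Y = {}}"
  have "\<exists>P\<in>?F. \<forall>K\<in>?F. P \<subseteq> K \<longrightarrow> K = P"
  proof (rule subset_Zorn_nonempty)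
    show "?F \<noteq> {}" using I by blast
    fix C assume C: "C \<noteq> {}" "subset.chain ?F C"
    then have CF: "ideal K R" "I \<subseteq> K" "K \<inter> Y = {}" if "K \<in> C" for K
      using that unfolding subset.chain_def by auto
    have "ideal (\<Union>C) R"
    proof (rule idealI_elementwise)
      show "\<Union>C \<subseteq> carrier R"
        using CF(1) by (meson Union_least additive_subgroup.a_subset ideal.axioms(1))
      obtain K where "K \<in> C" using C(1) by blast
      then show "\<zero> \<in> \<Union>C"
        using CF(1) by (meson UnionI additive_subgroup.zero_closed ideal.axioms(1))
    next
      fix x y assume "x \<in> \<Union>C" "y \<in> \<Union>C"
      then obtain J K where "J \<in> C" "K \<in> C" "x \<in> J" "y \<in> K" by blast
      moreover have "J \<subseteq> K \<or> K \<subseteq> J"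
        using C(2) \<open>J \<in> C\<close> \<open>K \<in> C\<close> unfolding subset_chain_def by blast
      ultimately obtain L where L: "L \<in> C" "x \<in> L" "y \<in> L" by blast
      interpret L: ideal L R using L(1) by (rule CF(1))
      show "x \<oplus> y \<in> \<Union>C"
        using L L.I_add by blast
    next
      fix x a assume "x \<in> \<Union>C" and a: "a \<in> carrier R"
      then obtain L where L: "L \<in> C" "x \<in> L" by blast
      interpret L: ideal L R using L(1) by (rule CF(1))
      show "a \<otimes> x \<in> \<Union>C" "x \<otimes> a \<in> \<Union>C"
        using L a L.I_l_closed L.I_r_closed by blast+
    qed
    then show "\<Union>C \<in> ?F" using C(1) CF(2,3) by blast
  qed
  then obtain P where P: "ideal P R" "I \<subseteq> P" "P \<inter> Y = {}"
    and max: "\<And>K. ideal K R \<Longrightarrow> P \<subseteq> K \<Longrightarrow> K \<inter> Y = {} \<Longrightarrow> K = P"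
    by auto
  interpret P: ideal P R by (fact P)
  \<comment> \<open>maximality of \<open>P\<close>: an ideal outside \<open>P\<close> hits \<open>Y\<close> after adding \<open>P\<close>\<close>
  have meet: "\<exists>p\<in>P. \<exists>j\<in>J. p \<oplus> j \<in> Y" if J: "ideal J R" and "\<not> J \<subseteq> P" for J
  proof (rule ccontr)
    interpret J: ideal J R by fact
    assume "\<not> ?thesis"
    then have "(P <+>\<^bsub>R\<^esub> J) \<inter> Y = {}" by (auto simp: set_add_def')
    moreover have "P \<subseteq> P <+>\<^bsub>R\<^esub> J" "J \<subseteq> P <+>\<^bsub>R\<^esub> J"
      using P.I_zero J.I_zero P.a_Hcarr J.a_Hcarr
      by (force simp: set_add_def' intro: bexI[of _ \<zero>])+
    ultimately show False
      using max[OF add_ideals[OF P(1) J]] \<open>\<not> J \<subseteq> P\<close> by blast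
  qed
  have "prime_ideal P R"
    unfolding prime_ideal_def
  proof (intro conjI allI impI P(1))
    show "P \<noteq> carrier R" using P(3) Y by blast
    fix J K assume J: "ideal J R" and K: "ideal K R" and JK: "J \<cdot> K \<subseteq> P"
    interpret J: ideal J R by fact
    interpret K: ideal K R by fact
    show "J \<subseteq> P \<or> K \<subseteq> P"
    proof (rule ccontr)
      assume "\<not> ?thesis"
      with meet[OF J] meet[OF K] obtain p j q k where *: "p \<in> P" "j \<in> J" "p \<oplus> j \<in> Y"
        "q \<in> P" "k \<in> K" "q \<oplus> k \<in> Y" by blast
      then obtain s where s: "s \<in> carrier R" "(p \<oplus> j) \<otimes> s \<otimes> (q \<oplus> k) \<in> Y"
        using m by blast
      have c: "p \<in> carrier R" "q \<in> carrier R" "j \<in> carrier R" "k \<in> carrier R"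
        using * by auto
      have "(p \<oplus> j) \<otimes> s \<otimes> (q \<oplus> k) = p \<otimes> (s \<otimes> (q \<oplus> k)) \<oplus> ((j \<otimes> s) \<otimes> q \<oplus> (j \<otimes> s) \<otimes> k)"
        using c s by (simp add: l_distr r_distr m_assoc a_ac)
      moreover have "(j \<otimes> s) \<otimes> k \<in> P"
        using ideal_prod.prod[OF J.I_r_closed[OF *(2) s(1)] *(5), of R] JK by blast
      ultimately have "(p \<oplus> j) \<otimes> s \<otimes> (q \<oplus> k) \<in> P"
        using P.I_r_closed[OF *(1)] P.I_l_closed[OF *(4)] c s by (simp add: P.I_add)
      then show False using s(2) P(3) by blast
    qed
  qed
  then show thesis using P(2,3) max that by blast
qed

lemma (in ring) subring_a_inv:
  assumes "subring B R" "x \<in> B"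
  shows "\<ominus>\<^bsub>R\<lparr>carrier := B\<rparr>\<^esub> x = \<ominus> x"
proof -
  interpret B: ring "R\<lparr>carrier := B\<rparr>" using assms(1) by (rule subring_is_ring)
  show ?thesis
    using assms subringE(1,5)[OF assms(1)] by (intro B.minus_equality) (auto simp: l_neg)
qed

text \<open>
  The complement of a prime ideal of \<open>S\<close> is an m-system of the whole ring, since the middle factor
  may be taken in \<open>S\<close>. Hence some prime ideal of the whole ring avoids it, and so does the prime
  radical.
\<close>

lemma (in ring) prime_radical_Int_prime_of_subring:
  assumes S: "subring S R" and P: "prime_ideal P (R\<lparr>carrier := S\<rparr>)"
  shows "prime_radical R \<inter> S \<subseteq> P"
proof
  fix x assume x: "x \<in> prime_radical R \<inter> S"
  interpret S: ring "R\<lparr>carrier := S\<rparr>" using S by (rule subring_is_ring)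
  have idP: "ideal P (R\<lparr>carrier := S\<rparr>)" using P unfolding prime_ideal_def by blast
  interpret P: ideal P "R\<lparr>carrier := S\<rparr>" by (fact idP)
  note S_sub = subringE(1)[OF S]
  show "x \<in> P"
  proof (rule ccontr)
    assume "x \<notin> P"
    have elem: "\<forall>a\<in>S. \<forall>b\<in>S. (\<forall>s\<in>S. a \<otimes> s \<otimes> b \<in> P) \<longrightarrow> a \<in> P \<or> b \<in> P"
      using P unfolding S.prime_ideal_iff_elementwise[OF idP] by simp
    have m: "\<exists>s\<in>carrier R. a \<otimes> s \<otimes> b \<in> S - P" if ab: "a \<in> S - P" "b \<in> S - P" for a b
    proof -
      obtain s where s: "s \<in> S" "a \<otimes> s \<otimes> b \<notin> P"
        using ab elem by blast
      then have "a \<otimes> s \<otimes> b \<in> S - P"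
        using ab subringE(6)[OF S] by simp
      then show ?thesis using s(1) S_sub by blast
    qed
    have "{\<zero>} \<inter> (S - P) = {}" "S - P \<noteq> {}" "S - P \<subseteq> carrier R"
      using P.I_zero S_sub x \<open>x \<notin> P\<close> by auto
    then obtain Q where "prime_ideal Q R" "Q \<inter> (S - P) = {}"
      using maximal_ideal_avoiding_m_system[OF zeroideal _ _ _ m] by metis
    then show False
      using x \<open>x \<notin> P\<close> unfolding prime_radical_def by blast
  qed
qed

text \<open>
  If \<open>x = x s x\<close> is nonzero, then \<open>{x}\<close> is an m-system that avoids \<open>0\<close>, so some prime ideal misses \<open>x\<close>.
\<close>

lemma (in ring) prime_radical_Int_regular_subring:
  assumes S: "subring S R" and reg: "von_neumann_regular (R\<lparr>carrier := S\<rparr>)"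
  shows "prime_radical R \<inter> S \<subseteq> {\<zero>}"
proof
  fix x assume x: "x \<in> prime_radical R \<inter> S"
  note S_sub = subringE(1)[OF S]
  obtain s where s: "s \<in> S" "x \<otimes> s \<otimes> x = x"
    using reg x unfolding von_neumann_regular_def by auto
  show "x \<in> {\<zero>}"
  proof (rule ccontr)
    assume "x \<notin> {\<zero>}"
    then have "{\<zero>} \<inter> {x} = {}" "{x} \<noteq> {}" "{x} \<subseteq> carrier R"
      using x S_sub by auto
    moreover have m: "\<exists>s\<in>carrier R. a \<otimes> s \<otimes> b \<in> {x}" if "a \<in> {x}" "b \<in> {x}" for a b
      using that s S_sub by auto
    ultimately obtain Q where "prime_ideal Q R" "Q \<inter> {x} = {}"
      using maximal_ideal_avoiding_m_system[OF zeroideal _ _ _ m] by metis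
    then show False
      using x unfolding prime_radical_def by blast
  qed
qed

lemma (in ring) prime_radical_ideal: "ideal (prime_radical R) R"
proof (rule idealI_elementwise)
  have id: "rng_ideal P R" if "prime_ideal P R" for P
    using that rng_ideal_iff_ideal unfolding prime_ideal_def by blast
  show "prime_radical R \<subseteq> carrier R"
    unfolding prime_radical_def by blast
  show "\<zero> \<in> prime_radical R"
    using id rng_ideal.I_zero unfolding prime_radical_def by blast
  fix x assume x: "x \<in> prime_radical R"
  then have xP: "x \<in> carrier R" "\<And>P. prime_ideal P R \<Longrightarrow> x \<in> P"
    unfolding prime_radical_def by blast+
  show "x \<oplus> y \<in> prime_radical R" if "y \<in> prime_radical R" for y
    using that xP id rng_ideal.I_add[of _ R x y] unfolding prime_radical_def by simp
  show "a \<otimes> x \<in> prime_radical R" "x \<otimes> a \<in> prime_radical R" if "a \<in> carrier R" for a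
    using that xP id rng_ideal.rng_I_l_closed[of _ R x a] rng_ideal.rng_I_r_closed[of _ R x a]
    unfolding prime_radical_def by simp_all
qed

lemma (in ring) idempotents_central_mod_prime_radicalD:
  assumes e: "e \<in> idempotents_central_mod_prime_radical R"
  shows "e \<in> carrier R" "e \<otimes> e = e"
    and "y \<in> carrier R \<Longrightarrow> e \<otimes> y \<ominus> y \<otimes> e \<in> prime_radical R"
proof -
  show c: "e \<in> carrier R" "e \<otimes> e = e"
    using e unfolding idempotents_central_mod_prime_radical_def by auto
  interpret P: ideal "prime_radical R" R by (rule prime_radical_ideal)
  assume y: "y \<in> carrier R"
  then have "prime_radical R +> y \<in> carrier (R Quot prime_radical R)"
    using P.quotient_map_surj by blast
  then have "prime_radical R +> (e \<otimes> y) = prime_radical R +> (y \<otimes> e)"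
    using e y c unfolding idempotents_central_mod_prime_radical_def central_in_def
    by (simp add: rng_homD(2)[OF P.quotient_map_rng_hom])
  then obtain p where p: "p \<in> prime_radical R" "e \<otimes> y = p \<oplus> y \<otimes> e"
    using c y by (auto simp: P.coset_eq_iff P.mem_coset_iff)
  then have "e \<otimes> y \<ominus> y \<otimes> e = p"
    using c y by (simp add: minus_eq a_assoc r_neg)
  then show "e \<otimes> y \<ominus> y \<otimes> e \<in> prime_radical R" using p by simp
qed

section \<open>Subrings that map onto a factor ring\<close>

lemma (in ring) ideal_Int_subring:
  assumes K: "ideal K R" and B: "subring B R"
  shows "ideal (K \<inter> B) (R\<lparr>carrier := B\<rparr>)"
proof -
  interpret K: ideal K R by fact
  interpret B: ring "R\<lparr>carrier := B\<rparr>" using B by (rule subring_is_ring)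
  show ?thesis
    by (rule B.idealI_elementwise)
      (use subringE(1,2,6,7)[OF B] in \<open>auto simp: K.I_zero K.I_add K.I_l_closed K.I_r_closed subset_iff\<close>)
qed

lemma (in ring) Int_subring_coset_eq:
  assumes K: "ideal K R" and B: "subring B R" and x: "x \<in> B" and y: "y \<in> B"
  shows "K +> x = K +> y \<longleftrightarrow>
    (K \<inter> B) +>\<^bsub>R\<lparr>carrier := B\<rparr>\<^esub> x = (K \<inter> B) +>\<^bsub>R\<lparr>carrier := B\<rparr>\<^esub> y"
proof -
  interpret K: ideal K R by fact
  interpret KB: ideal "K \<inter> B" "R\<lparr>carrier := B\<rparr>" using K B by (rule ideal_Int_subring)
  note B_sub = subringE(1)[OF B, THEN subsetD]
  have "k \<in> B" if k: "k \<in> K" "x = k \<oplus> y" for k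
  proof -
    have "k = x \<oplus> \<ominus> y" using k x y B_sub by (simp add: a_assoc r_neg)
    then show ?thesis using x y subringE(5,7)[OF B] by simp
  qed
  then have "(\<exists>k\<in>K. x = k \<oplus> y) \<longleftrightarrow> (\<exists>k\<in>K \<inter> B. x = k \<oplus> y)" by blast
  then show ?thesis
    using x y B_sub by (simp add: K.coset_eq_iff KB.coset_eq_iff K.mem_coset_iff KB.mem_coset_iff)
qed

text \<open>
  The hypothesis that \<open>B\<close> and \<open>K\<close> together fill the ring says that \<open>B\<close> maps onto the quotient by \<open>K\<close>.
\<close>

lemma (in ring) quotient_Int_subring_isomorphic:
  assumes K: "ideal K R" and B: "subring B R" and cover: "carrier R \<subseteq> B <+>\<^bsub>R\<^esub> K"
  shows "rng_isomorphic (R Quot K) (R\<lparr>carrier := B\<rparr> Quot (K \<inter> B))"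
    and "rng_isomorphic (R\<lparr>carrier := B\<rparr> Quot (K \<inter> B)) (R Quot K)"
proof -
  interpret K: ideal K R by fact
  interpret KB: ideal "K \<inter> B" "R\<lparr>carrier := B\<rparr>" using K B by (rule ideal_Int_subring)
  note B_sub = subringE(1)[OF B, THEN subsetD]
  have hom: "(+>) K \<in> rng_hom (R\<lparr>carrier := B\<rparr>) (R Quot K)"
    using K.quotient_map_rng_hom B_sub by (auto simp: rng_hom_def hom_def)
  have "K +> s \<in> (+>) K ` B" if s: "s \<in> carrier R" for s
  proof -
    obtain b k where bk: "b \<in> B" "k \<in> K" "s = b \<oplus> k"
      using cover s by (auto simp: set_add_def')
    then have "K +> s = K +> b"
      using B_sub s a_comm[of b k]
      by (subst K.coset_eq_iff) (auto simp: K.mem_coset_iff intro!: bexI[of _ k])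
    then show ?thesis using bk by blast
  qed
  then have surj: "(+>) K ` carrier (R\<lparr>carrier := B\<rparr>) = carrier (R Quot K)"
    using B_sub unfolding K.quotient_map_surj[symmetric] by auto
  note eq = Int_subring_coset_eq[OF K B]
  show "rng_isomorphic (R Quot K) (R\<lparr>carrier := B\<rparr> Quot (K \<inter> B))"
    by (rule rng_isomorphic_if_same_kernel[OF KB.rng_axioms hom surj
          KB.quotient_map_rng_hom KB.quotient_map_surj]) (simp add: eq)
  show "rng_isomorphic (R\<lparr>carrier := B\<rparr> Quot (K \<inter> B)) (R Quot K)"
    by (rule rng_isomorphic_if_same_kernel[OF KB.rng_axioms
          KB.quotient_map_rng_hom KB.quotient_map_surj hom surj]) (simp add: eq)
qed

text \<open>
  Modulo \<open>K\<close> every element of the ring is represented by an element of \<open>B\<close>, so the elementwise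
  criterion for primeness of \<open>K\<close> only has to be tested on \<open>B\<close>.
\<close>

lemma (in ring) prime_ideal_Int_subring_iff:
  assumes K: "ideal K R" and B: "subring B R" and cover: "carrier R \<subseteq> B <+>\<^bsub>R\<^esub> K"
  shows "prime_ideal (K \<inter> B) (R\<lparr>carrier := B\<rparr>) \<longleftrightarrow> prime_ideal K R"
proof -
  interpret K: ideal K R by fact
  interpret B: ring "R\<lparr>carrier := B\<rparr>" using B by (rule subring_is_ring)
  note B_sub = subringE(1)[OF B, THEN subsetD]
  have dec: "\<exists>b\<in>B. \<exists>k\<in>K. s = b \<oplus> k" if "s \<in> carrier R" for s
    using subsetD[OF cover that] by (auto simp: set_add_def')
  have proper: "K \<inter> B = B \<longleftrightarrow> K = carrier R"
  proof
    assume "K \<inter> B = B"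
    then have "\<one> \<in> K" using subringE(3)[OF B] by blast
    then show "K = carrier R" by (rule K.one_imp_carrier)
  qed (use B_sub in auto)
  have prod_iff: "(b \<oplus> k) \<otimes> s \<otimes> (c \<oplus> l) \<in> K \<longleftrightarrow> b \<otimes> t \<otimes> c \<in> K"
    if "b \<in> B" "c \<in> B" "t \<in> B" "k \<in> K" "l \<in> K" "m \<in> K" "s = t \<oplus> m" for b c t k l m s
  proof -
    have c: "b \<in> carrier R" "c \<in> carrier R" "t \<in> carrier R" "k \<in> carrier R" "l \<in> carrier R"
      "m \<in> carrier R" using that B_sub by auto
    \<comment> \<open>the part of the product that contains a factor from \<open>K\<close>\<close>
    define i where "i = k \<otimes> (s \<otimes> (c \<oplus> l)) \<oplus> ((b \<otimes> s) \<otimes> l \<oplus> b \<otimes> (m \<otimes> c))"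
    have i: "i \<in> K"
      using that c unfolding i_def by (simp add: K.I_add K.I_l_closed K.I_r_closed)
    have eq: "(b \<oplus> k) \<otimes> s \<otimes> (c \<oplus> l) = i \<oplus> b \<otimes> t \<otimes> c"
      unfolding i_def that(7) using c by (simp add: l_distr r_distr m_assoc a_ac)
    have "b \<otimes> t \<otimes> c \<in> K" if "i \<oplus> b \<otimes> t \<otimes> c \<in> K"
    proof -
      have "b \<otimes> t \<otimes> c = \<ominus> i \<oplus> (i \<oplus> b \<otimes> t \<otimes> c)"
        using i c by (simp add: a_assoc[symmetric] l_neg)
      then show ?thesis using that i by (metis K.I_add K.I_minus)
    qed
    then show ?thesis unfolding eq using i K.I_add by blast
  qed
  have mem_iff: "b \<oplus> k \<in> K \<longleftrightarrow> b \<in> K" if "b \<in> B" "k \<in> K" for b k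
  proof -
    have "b = (b \<oplus> k) \<oplus> \<ominus> k" using that B_sub by (simp add: a_assoc r_neg)
    then show ?thesis using that by (metis K.I_add K.I_minus)
  qed
  have "(\<forall>x\<in>carrier R. \<forall>y\<in>carrier R. (\<forall>s\<in>carrier R. x \<otimes> s \<otimes> y \<in> K) \<longrightarrow> x \<in> K \<or> y \<in> K) \<longleftrightarrow>
    (\<forall>b\<in>B. \<forall>c\<in>B. (\<forall>t\<in>B. b \<otimes> t \<otimes> c \<in> K) \<longrightarrow> b \<in> K \<or> c \<in> K)" (is "?l \<longleftrightarrow> ?r")
  proof
    assume l: ?l
    show ?r
    proof (intro ballI impI)
      fix b c assume bc: "b \<in> B" "c \<in> B" "\<forall>t\<in>B. b \<otimes> t \<otimes> c \<in> K"
      have "b \<otimes> s \<otimes> c \<in> K" if s: "s \<in> carrier R" for s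
      proof -
        obtain t m where tm: "t \<in> B" "m \<in> K" "s = t \<oplus> m" using dec[OF s] by blast
        from prod_iff[OF bc(1,2) tm(1) K.I_zero K.I_zero tm(2,3)] bc tm(1)
        show ?thesis by (simp add: B_sub)
      qed
      then show "b \<in> K \<or> c \<in> K" using l B_sub bc by blast
    qed
  next
    assume r: ?r
    show ?l
    proof (intro ballI impI)
      fix x y assume xy: "x \<in> carrier R" "y \<in> carrier R" "\<forall>s\<in>carrier R. x \<otimes> s \<otimes> y \<in> K"
      obtain b k where bk: "b \<in> B" "k \<in> K" "x = b \<oplus> k" using dec[OF xy(1)] by blast
      obtain c l where cl: "c \<in> B" "l \<in> K" "y = c \<oplus> l" using dec[OF xy(2)] by blast
      have "b \<otimes> t \<otimes> c \<in> K" if t: "t \<in> B" for t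
      proof -
        have "t = t \<oplus> \<zero>" using t B_sub by simp
        from prod_iff[OF bk(1) cl(1) t bk(2) cl(2) K.I_zero this] show ?thesis
          using xy(3) t B_sub bk cl by simp
      qed
      then have "b \<in> K \<or> c \<in> K" using r bk cl by blast
      then show "x \<in> K \<or> y \<in> K" using mem_iff bk cl by simp
    qed
  qed
  moreover have "(\<forall>b\<in>B. \<forall>c\<in>B. (\<forall>t\<in>B. b \<otimes> t \<otimes> c \<in> K) \<longrightarrow> b \<in> K \<or> c \<in> K) \<longleftrightarrow>
    (\<forall>b\<in>B. \<forall>c\<in>B. (\<forall>t\<in>B. b \<otimes> t \<otimes> c \<in> K \<inter> B) \<longrightarrow> b \<in> K \<inter> B \<or> c \<in> K \<inter> B)"
    using subringE(6)[OF B] by simp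
  ultimately show ?thesis
    using proper by (simp add: prime_ideal_iff_elementwise[OF K]
        B.prime_ideal_iff_elementwise[OF ideal_Int_subring[OF K B]])
qed

text \<open>
  The ideals of the quotient by \<open>K\<close> correspond to those of \<open>B\<close> above \<open>K \<inter> B\<close>. In particular every such
  ideal \<open>J\<close> is contracted from the ideal \<open>J + K\<close>.
\<close>

lemma (in ring) subring_ideal_extension:
  assumes K: "ideal K R" and B: "subring B R" and cover: "carrier R \<subseteq> B <+>\<^bsub>R\<^esub> K"
    and J: "ideal J (R\<lparr>carrier := B\<rparr>)" and KJ: "K \<inter> B \<subseteq> J"
  shows "ideal (J <+>\<^bsub>R\<^esub> K) R" and "(J <+>\<^bsub>R\<^esub> K) \<inter> B = J" and "J \<subseteq> J <+>\<^bsub>R\<^esub> K" and "K \<subseteq> J <+>\<^bsub>R\<^esub> K"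
proof -
  interpret K: ideal K R by fact
  interpret J: ideal J "R\<lparr>carrier := B\<rparr>" by fact
  note B_sub = subringE(1)[OF B, THEN subsetD]
  have JB: "j \<in> B" if "j \<in> J" for j using J.a_Hcarr that by simp
  have J0: "\<zero> \<in> J" using J.I_zero by simp
  have Jadd: "i \<oplus> j \<in> J" if "i \<in> J" "j \<in> J" for i j using J.I_add[OF that] by simp
  have mem: "x \<in> J <+>\<^bsub>R\<^esub> K \<longleftrightarrow> (\<exists>j\<in>J. \<exists>k\<in>K. x = j \<oplus> k)" for x
    by (auto simp: set_add_def')
  have JK: "j \<oplus> k \<in> J <+>\<^bsub>R\<^esub> K" if "j \<in> J" "k \<in> K" for j k using that mem by blast
  show J_le: "J \<subseteq> J <+>\<^bsub>R\<^esub> K"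
  proof
    fix j assume j: "j \<in> J"
    then show "j \<in> J <+>\<^bsub>R\<^esub> K" using JK[OF j K.I_zero] JB B_sub by simp
  qed
  show "K \<subseteq> J <+>\<^bsub>R\<^esub> K"
  proof
    fix k assume k: "k \<in> K"
    then show "k \<in> J <+>\<^bsub>R\<^esub> K" using JK[OF J0 k] by simp
  qed
  show "ideal (J <+>\<^bsub>R\<^esub> K) R"
  proof (rule idealI_elementwise)
    show "J <+>\<^bsub>R\<^esub> K \<subseteq> carrier R" using JB B_sub by (auto simp: mem)
    show "\<zero> \<in> J <+>\<^bsub>R\<^esub> K" using J_le J0 by blast
  next
    fix x y assume "x \<in> J <+>\<^bsub>R\<^esub> K" "y \<in> J <+>\<^bsub>R\<^esub> K"
    then obtain i k j l where *: "i \<in> J" "k \<in> K" "x = i \<oplus> k" "j \<in> J" "l \<in> K" "y = j \<oplus> l"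
      unfolding mem by blast
    then have "x \<oplus> y = (i \<oplus> j) \<oplus> (k \<oplus> l)"
      using JB B_sub by (simp add: a_ac)
    then show "x \<oplus> y \<in> J <+>\<^bsub>R\<^esub> K" using * JK[OF Jadd K.I_add] by simp
  next
    fix x a assume "x \<in> J <+>\<^bsub>R\<^esub> K" and a: "a \<in> carrier R"
    then obtain j k b l where *: "j \<in> J" "k \<in> K" "x = j \<oplus> k" "b \<in> B" "l \<in> K" "a = b \<oplus> l"
      using subsetD[OF cover a] unfolding mem by (auto simp: set_add_def')
    have c: "j \<in> carrier R" "k \<in> carrier R" "b \<in> carrier R" "l \<in> carrier R"
      using * JB B_sub by auto
    have "a \<otimes> x = b \<otimes> j \<oplus> (a \<otimes> k \<oplus> l \<otimes> j)" "x \<otimes> a = j \<otimes> b \<oplus> (k \<otimes> a \<oplus> j \<otimes> l)"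
      using c *(3,6) by (simp_all add: l_distr r_distr a_ac)
    moreover have "b \<otimes> j \<in> J" "j \<otimes> b \<in> J"
      using *(1,4) J.I_l_closed[of j b] J.I_r_closed[of j b] by simp_all
    moreover have "a \<otimes> k \<oplus> l \<otimes> j \<in> K" "k \<otimes> a \<oplus> j \<otimes> l \<in> K"
      by (intro K.I_add K.I_l_closed[OF *(2) a] K.I_r_closed[OF *(2) a]
          K.I_l_closed[OF *(5) c(1)] K.I_r_closed[OF *(5) c(1)])+
    ultimately show "a \<otimes> x \<in> J <+>\<^bsub>R\<^esub> K" "x \<otimes> a \<in> J <+>\<^bsub>R\<^esub> K"
      using JK by simp_all
  qed
  have "x \<in> J" if "x \<in> J <+>\<^bsub>R\<^esub> K" "x \<in> B" for x
  proof -
    obtain j k where jk: "j \<in> J" "k \<in> K" "x = j \<oplus> k" using \<open>x \<in> J <+>\<^bsub>R\<^esub> K\<close> mem by blast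
    then have "k = \<ominus> j \<oplus> x" using JB B_sub by (simp add: a_assoc[symmetric] l_neg)
    then have "k \<in> B" using jk(1) JB \<open>x \<in> B\<close> subringE(5,7)[OF B] by simp
    then have "k \<in> J" using jk(2) KJ by blast
    then show ?thesis using jk Jadd by simp
  qed
  then show "(J <+>\<^bsub>R\<^esub> K) \<inter> B = J" using J_le JB by blast
qed

section \<open>Primes, dimension and radicals when all prime factors are covered\<close>

text \<open>
  Modulo \<open>P\<close> the generators \<open>e\<close> are central idempotents, so \<open>e A (1 - e) = 0\<close>; in a prime ring this
  forces \<open>e = 0\<close> or \<open>e = 1\<close>. Both values lie in the image of \<open>B\<close>, so adjoining \<open>E\<close> does not enlarge that
  image.
\<close>

lemma (in ring) generated_by_idempotents_cover_prime_factor: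
  assumes B: "subring B R" and gen: "carrier R = generate_ring R (B \<union> E)"
    and idem: "\<And>e. e \<in> E \<Longrightarrow> e \<otimes> e = e"
    and P: "prime_ideal P R"
    and central: "\<And>e y. e \<in> E \<Longrightarrow> y \<in> carrier R \<Longrightarrow> e \<otimes> y \<ominus> y \<otimes> e \<in> P"
  shows "carrier R \<subseteq> B <+>\<^bsub>R\<^esub> P"
proof
  have idP: "ideal P R" using P unfolding prime_ideal_def by blast
  interpret P: ideal P R by (fact idP)
  note B_sub = subringE(1)[OF B, THEN subsetD]
  have E_sub: "e \<in> carrier R" if "e \<in> E" for e
    unfolding gen using that by (simp add: generate_ring.incl)
  have mem: "x \<in> B <+>\<^bsub>R\<^esub> P \<longleftrightarrow> (\<exists>b\<in>B. \<exists>p\<in>P. x = b \<oplus> p)" for x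
    by (auto simp: set_add_def')
  have BP: "b \<oplus> p \<in> B <+>\<^bsub>R\<^esub> P" if "b \<in> B" "p \<in> P" for b p using that mem by blast
  have e01: "e \<in> P \<or> \<one> \<ominus> e \<in> P" if e: "e \<in> E" for e
  proof -
    have c: "e \<in> carrier R" using E_sub[OF e] .
    have "e \<otimes> y \<otimes> (\<one> \<ominus> e) \<in> P" if y: "y \<in> carrier R" for y
    proof -
      \<comment> \<open>the second summand of the commutator dies against \<open>1 - e\<close>, so \<open>e y (1 - e)\<close> is a multiple of the commutator\<close>
      have "y \<otimes> e \<otimes> (\<one> \<ominus> e) = \<zero>"
        using c y idem[OF e] by (simp add: minus_eq r_distr r_minus m_assoc r_neg)
      then have "e \<otimes> y \<otimes> (\<one> \<ominus> e) = (e \<otimes> y \<ominus> y \<otimes> e) \<otimes> (\<one> \<ominus> e)"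
        using c y by (simp add: minus_eq[of "e \<otimes> y"] l_distr l_minus)
      then show ?thesis
        using P.I_r_closed[OF central[OF e y]] c by simp
    qed
    then show ?thesis
      using P c unfolding prime_ideal_iff_elementwise[OF idP] by (meson minus_closed one_closed)
  qed
  fix s assume "s \<in> carrier R"
  then have "s \<in> generate_ring R (B \<union> E)" using gen by simp
  then show "s \<in> B <+>\<^bsub>R\<^esub> P"
  proof induction
    case one
    show ?case using BP[OF subringE(3)[OF B] P.I_zero] by simp
  next
    case (incl h)
    show ?case
    proof (cases "h \<in> B")
      case True
      then show ?thesis using BP[OF _ P.I_zero] B_sub by simp
    next
      case False
      with incl have h: "h \<in> E" by blast
      then have c: "h \<in> carrier R" by (rule E_sub)
      from e01[OF h] show ?thesis
      proof
        assume "h \<in> P"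
        then show ?thesis using BP[OF subringE(2)[OF B]] c by simp
      next
        assume "\<one> \<ominus> h \<in> P"
        then have "\<one> \<oplus> \<ominus> (\<one> \<ominus> h) \<in> B <+>\<^bsub>R\<^esub> P" by (intro BP subringE(3)[OF B] P.I_minus)
        moreover have "\<one> \<oplus> \<ominus> (\<one> \<ominus> h) = h"
          using c by (simp add: minus_eq minus_add a_assoc[symmetric] r_neg)
        ultimately show ?thesis by simp
      qed
    qed
  next
    case (a_inv h)
    then obtain b p where bp: "b \<in> B" "p \<in> P" "h = b \<oplus> p" unfolding mem by blast
    then have "\<ominus> h = \<ominus> b \<oplus> \<ominus> p" using B_sub by (simp add: minus_add)
    then show ?case using bp BP[OF subringE(5)[OF B] P.I_minus] by simp
  next
    case (eng_add h g)
    then obtain b p c q where bp: "b \<in> B" "p \<in> P" "h = b \<oplus> p" "c \<in> B" "q \<in> P" "g = c \<oplus> q"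
      unfolding mem by blast
    then have "h \<oplus> g = (b \<oplus> c) \<oplus> (p \<oplus> q)" using B_sub by (simp add: a_ac)
    then show ?case using bp BP[OF subringE(7)[OF B] P.I_add] by simp
  next
    case (eng_mult h g)
    then obtain b p c q where bp: "b \<in> B" "p \<in> P" "h = b \<oplus> p" "c \<in> B" "q \<in> P" "g = c \<oplus> q"
      unfolding mem by blast
    then have g: "g \<in> carrier R" using B_sub by simp
    have "h \<otimes> g = (b \<otimes> c) \<oplus> (p \<otimes> g \<oplus> b \<otimes> q)"
      using bp B_sub by (simp add: l_distr r_distr a_ac)
    moreover have "p \<otimes> g \<oplus> b \<otimes> q \<in> P"
      by (intro P.I_add P.I_r_closed[OF bp(2) g] P.I_l_closed[OF bp(5) B_sub[OF bp(1)]])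
    ultimately show ?case using bp BP[OF subringE(6)[OF B]] by simp
  qed
qed

text \<open>
  The complement of \<open>J\<close> in \<open>B\<close> is an m-system of the whole ring, so there is a prime ideal \<open>P\<close> that is
  maximal with \<open>P \<inter> B \<subseteq> J\<close>. By the covering hypothesis \<open>J + P\<close> is an ideal whose contraction is \<open>J\<close>;
  maximality gives \<open>J + P = P\<close>, hence equality.
\<close>

lemma (in ring) prime_ideal_lying_over:
  assumes B: "subring B R"
    and cover: "\<And>P. prime_ideal P R \<Longrightarrow> carrier R \<subseteq> B <+>\<^bsub>R\<^esub> P"
    and J: "prime_ideal J (R\<lparr>carrier := B\<rparr>)"
  obtains P where "prime_ideal P R" "P \<inter> B = J"
proof -
  interpret B: ring "R\<lparr>carrier := B\<rparr>" using B by (rule subring_is_ring)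
  have idJ: "ideal J (R\<lparr>carrier := B\<rparr>)" using J unfolding prime_ideal_def by blast
  interpret J: ideal J "R\<lparr>carrier := B\<rparr>" by (fact idJ)
  note B_sub = subringE(1)[OF B]
  have JB: "J \<subseteq> B" using J.a_subset by simp
  have elem: "\<forall>a\<in>B. \<forall>b\<in>B. (\<forall>s\<in>B. a \<otimes> s \<otimes> b \<in> J) \<longrightarrow> a \<in> J \<or> b \<in> J"
    and "J \<noteq> B"
    using J unfolding B.prime_ideal_iff_elementwise[OF idJ] by simp_all
  have m: "\<exists>s\<in>carrier R. a \<otimes> s \<otimes> b \<in> B - J" if ab: "a \<in> B - J" "b \<in> B - J" for a b
  proof -
    obtain s where s: "s \<in> B" "a \<otimes> s \<otimes> b \<notin> J"
      using ab elem by blast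
    then have "a \<otimes> s \<otimes> b \<in> B - J"
      using ab subringE(6)[OF B] by simp
    then show ?thesis using s(1) B_sub by blast
  qed
  have "{\<zero>} \<inter> (B - J) = {}" "B - J \<noteq> {}" "B - J \<subseteq> carrier R"
    using J.I_zero B_sub \<open>J \<noteq> B\<close> JB by auto
  then obtain P where P: "prime_ideal P R" "P \<inter> (B - J) = {}"
    and max: "\<And>K. ideal K R \<Longrightarrow> P \<subseteq> K \<Longrightarrow> K \<inter> (B - J) = {} \<Longrightarrow> K = P"
    using maximal_ideal_avoiding_m_system[OF zeroideal _ _ _ m] by metis
  have idP: "ideal P R" using P(1) unfolding prime_ideal_def by blast
  have PJ: "P \<inter> B \<subseteq> J" using P(2) by blast
  note ext = subring_ideal_extension[OF idP B cover[OF P(1)] idJ PJ]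
  have "J <+>\<^bsub>R\<^esub> P = P"
    by (rule max[OF ext(1) ext(4)]) (use ext(2) in blast)
  then have "P \<inter> B = J"
    using ext(3) PJ JB by blast
  then show thesis using that P(1) by blast
qed

text \<open>
  Subtracting an element of \<open>P\<close> moves an element of \<open>Q\<close> outside \<open>P\<close> into \<open>B\<close>.
\<close>

lemma (in ring) prime_ideal_Int_subring_strict_mono:
  assumes B: "subring B R"
    and cover: "\<And>P. prime_ideal P R \<Longrightarrow> carrier R \<subseteq> B <+>\<^bsub>R\<^esub> P"
    and P: "prime_ideal P R" "prime_ideal Q R" "P \<subset> Q"
  shows "P \<inter> B \<subset> Q \<inter> B"
proof -
  have id: "ideal P R" "ideal Q R" using P unfolding prime_ideal_def by auto
  interpret P: ideal P R by (fact id)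
  interpret Q: ideal Q R by (fact id)
  obtain q where q: "q \<in> Q" "q \<notin> P" using P(3) by blast
  then obtain b p where bp: "b \<in> B" "p \<in> P" "q = b \<oplus> p"
    using subsetD[OF cover[OF P(1)] Q.a_Hcarr[OF q(1)]] by (auto simp: set_add_def')
  have c: "b \<in> carrier R" "p \<in> carrier R" using bp subringE(1)[OF B] by auto
  have "b \<in> Q"
  proof -
    have "b = q \<oplus> \<ominus> p" using bp c by (simp add: a_assoc r_neg)
    then show ?thesis using Q.I_add[OF q(1) Q.I_minus] bp(2) P(3) by blast
  qed
  moreover have "b \<notin> P" using q bp P.I_add by blast
  ultimately show ?thesis using bp(1) P(3) by blast
qed

text \<open>
  Contraction carries strict chains of primes to strict chains. In the other direction a single
  prime \<open>P\<close> over the bottom member of a chain \<open>J\<^sub>0 \<subset> \<dots> \<subset> J\<^sub>n\<close> suffices: the ideals \<open>J\<^sub>i + P\<close> are prime and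
  contract to the \<open>J\<^sub>i\<close>.
\<close>

theorem (in ring) classical_krull_dim_subring:
  assumes B: "subring B R"
    and cover: "\<And>P. prime_ideal P R \<Longrightarrow> carrier R \<subseteq> B <+>\<^bsub>R\<^esub> P"
  shows "classical_krull_dim (R\<lparr>carrier := B\<rparr>) = classical_krull_dim R"
proof -
  let ?B = "R\<lparr>carrier := B\<rparr>"
  have id: "ideal P R" if "prime_ideal P R" for P
    using that unfolding prime_ideal_def by blast
  have "(\<exists>P. (\<forall>i\<le>n. prime_ideal (P i) ?B) \<and> (\<forall>i<n. P i \<subset> P (Suc i))) \<longleftrightarrow>
    (\<exists>P. (\<forall>i\<le>n. prime_ideal (P i) R) \<and> (\<forall>i<n. P i \<subset> P (Suc i)))" for n :: nat
  proof
    assume "\<exists>P. (\<forall>i\<le>n. prime_ideal (P i) R) \<and> (\<forall>i<n. P i \<subset> P (Suc i))"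
    then obtain P where P: "\<And>i. i \<le> n \<Longrightarrow> prime_ideal (P i) R" "\<And>i. i < n \<Longrightarrow> P i \<subset> P (Suc i)"
      by blast
    have "prime_ideal (P i \<inter> B) ?B" if "i \<le> n" for i
      using prime_ideal_Int_subring_iff[OF id[OF P(1)] B cover[OF P(1)]] P(1) that by blast
    moreover have "P i \<inter> B \<subset> P (Suc i) \<inter> B" if "i < n" for i
      using prime_ideal_Int_subring_strict_mono[OF B cover P(1) P(1) P(2)] that by simp
    ultimately show "\<exists>P. (\<forall>i\<le>n. prime_ideal (P i) ?B) \<and> (\<forall>i<n. P i \<subset> P (Suc i))"
      by (intro exI[of _ "\<lambda>i. P i \<inter> B"]) blast
  next
    assume "\<exists>P. (\<forall>i\<le>n. prime_ideal (P i) ?B) \<and> (\<forall>i<n. P i \<subset> P (Suc i))"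
    then obtain J where J: "\<And>i. i \<le> n \<Longrightarrow> prime_ideal (J i) ?B" "\<And>i. i < n \<Longrightarrow> J i \<subset> J (Suc i)"
      by blast
    obtain P where P: "prime_ideal P R" "P \<inter> B = J 0"
      using prime_ideal_lying_over[OF B cover J(1)[of 0]] by blast
    have mono: "J 0 \<subseteq> J i" if "i \<le> n" for i
      using that
    proof (induction i)
      case (Suc i)
      then show ?case using J(2)[of i] by auto
    qed simp
    have JB: "ideal (J i) ?B" if "i \<le> n" for i
      using J(1)[OF that] unfolding prime_ideal_def by blast
    have PJ: "P \<inter> B \<subseteq> J i" if "i \<le> n" for i
      using P(2) mono[OF that] by simp
    note ext = subring_ideal_extension[OF id[OF P(1)] B cover[OF P(1)] JB PJ]
    have prime: "prime_ideal (J i <+>\<^bsub>R\<^esub> P) R" if i: "i \<le> n" for i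
    proof -
      have "carrier R \<subseteq> B <+>\<^bsub>R\<^esub> (J i <+>\<^bsub>R\<^esub> P)"
        using cover[OF P(1)] ext(4)[OF i i] by (fastforce simp: set_add_def')
      then show ?thesis
        using prime_ideal_Int_subring_iff[OF ext(1)[OF i i] B] J(1)[OF i] ext(2)[OF i i] by simp
    qed
    have strict: "J i <+>\<^bsub>R\<^esub> P \<subset> J (Suc i) <+>\<^bsub>R\<^esub> P" if i: "i < n" for i
    proof -
      have "J i <+>\<^bsub>R\<^esub> P \<subseteq> J (Suc i) <+>\<^bsub>R\<^esub> P"
        using J(2)[OF i] unfolding set_add_def' by blast
      moreover have "J i <+>\<^bsub>R\<^esub> P \<noteq> J (Suc i) <+>\<^bsub>R\<^esub> P"
        using J(2)[OF i] ext(2)[of i] ext(2)[of "Suc i"] i by (metis Suc_leI less_imp_le psubset_eq)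
      ultimately show ?thesis by blast
    qed
    show "\<exists>P. (\<forall>i\<le>n. prime_ideal (P i) R) \<and> (\<forall>i<n. P i \<subset> P (Suc i))"
      by (intro exI[of _ "\<lambda>i. J i <+>\<^bsub>R\<^esub> P"]) (use prime strict in blast)
  qed
  then show ?thesis unfolding classical_krull_dim_def by simp
qed

lemma (in ring) prime_ideal_if_prime_quotient:
  assumes I: "ideal I R" and prime: "prime_rng (R Quot I)" and "I \<noteq> carrier R"
  shows "prime_ideal I R"
  unfolding prime_ideal_def
proof (intro conjI allI impI assms(1,3))
  fix J K assume JK: "ideal J R" "ideal K R" "J \<cdot> K \<subseteq> I"
  have "x \<otimes> y \<in> I" if "x \<in> J" "y \<in> K" for x y
    using ideal_prod.prod[OF that] JK(3) by blast
  with I JK(1,2) show "J \<subseteq> I \<or> K \<subseteq> I"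
    unfolding rng_ideal_iff_ideal[symmetric] by (intro prime_quotient_rng_ideals[OF _ prime])
qed

text \<open>
  Quotients in a special class are zero or come from prime ideals. The covering hypothesis and lying
  over match the primes of the ring with those of \<open>B\<close> in such a way that corresponding factor rings
  are isomorphic, and therefore belong to \<open>M\<close> simultaneously.
\<close>

theorem (in ring) upper_radical_subring:
  fixes M :: "'a set ring set"
  assumes M: "special_class M" and B: "subring B R"
    and cover: "\<And>P. prime_ideal P R \<Longrightarrow> carrier R \<subseteq> B <+>\<^bsub>R\<^esub> P"
  shows "upper_radical M (R\<lparr>carrier := B\<rparr>) = upper_radical M R \<inter> B"
proof -
  interpret B: ring "R\<lparr>carrier := B\<rparr>" using B by (rule subring_is_ring)
  note B_sub = subringE(1)[OF B]
  have iso: "C \<in> M" if "A \<in> M" "rng C" "rng_isomorphic A C" for A C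
    using M that unfolding special_class_def by blast
  have primeM: "prime_rng A" if "A \<in> M" for A
    using M that unfolding special_class_def by blast
  have down: "x \<in> I"
    if x: "x \<in> B" "\<And>J. ideal J (R\<lparr>carrier := B\<rparr>) \<Longrightarrow> R\<lparr>carrier := B\<rparr> Quot J \<in> M \<Longrightarrow> x \<in> J"
      and I: "ideal I R" "R Quot I \<in> M" for x I
  proof (cases "I = carrier R")
    case True
    then show ?thesis using x(1) B_sub by blast
  next
    case False
    interpret IB: ideal "I \<inter> B" "R\<lparr>carrier := B\<rparr>"
      using I(1) B by (rule ideal_Int_subring)
    have "prime_ideal I R"
      using False prime_ideal_if_prime_quotient I primeM by blast
    then have "rng_isomorphic (R Quot I) (R\<lparr>carrier := B\<rparr> Quot (I \<inter> B))"
      using quotient_Int_subring_isomorphic(1)[OF I(1) B] cover by blast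
    then have "R\<lparr>carrier := B\<rparr> Quot (I \<inter> B) \<in> M"
      using iso[OF I(2)] IB.quotient_rng by blast
    then show ?thesis using x(2) IB.ideal_axioms by blast
  qed
  have up: "x \<in> J"
    if x: "x \<in> B" "\<And>I. ideal I R \<Longrightarrow> R Quot I \<in> M \<Longrightarrow> x \<in> I"
      and J: "ideal J (R\<lparr>carrier := B\<rparr>)" "R\<lparr>carrier := B\<rparr> Quot J \<in> M" for x J
  proof (cases "J = B")
    case True
    then show ?thesis using x(1) by blast
  next
    case False
    then have "prime_ideal J (R\<lparr>carrier := B\<rparr>)"
      using B.prime_ideal_if_prime_quotient[OF J(1)] J(2) primeM by simp
    then obtain P where P: "prime_ideal P R" "P \<inter> B = J"
      using prime_ideal_lying_over[OF B cover] by metis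
    interpret P: ideal P R using P(1) unfolding prime_ideal_def by blast
    have "rng_isomorphic (R\<lparr>carrier := B\<rparr> Quot J) (R Quot P)"
      using quotient_Int_subring_isomorphic(2)[OF P.ideal_axioms B cover[OF P(1)]] P(2) by simp
    then have "R Quot P \<in> M"
      using iso[OF J(2)] P.quotient_rng by blast
    then show ?thesis using x(2) P.ideal_axioms P(2) x(1) by blast
  qed
  show ?thesis
    unfolding upper_radical_special_class[OF M rng_axioms]
      upper_radical_special_class[OF M B.rng_axioms] rng_ideal_iff_ideal B.rng_ideal_iff_ideal
  proof (intro equalityI subsetI)
    fix x assume "x \<in> {x \<in> carrier (R\<lparr>carrier := B\<rparr>). \<forall>J. ideal J (R\<lparr>carrier := B\<rparr>) \<longrightarrow>
        R\<lparr>carrier := B\<rparr> Quot J \<in> M \<longrightarrow> x \<in> J}"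
    then have "x \<in> B" "\<And>J. ideal J (R\<lparr>carrier := B\<rparr>) \<Longrightarrow> R\<lparr>carrier := B\<rparr> Quot J \<in> M \<Longrightarrow> x \<in> J"
      by simp_all
    then show "x \<in> {x \<in> carrier R. \<forall>I. ideal I R \<longrightarrow> R Quot I \<in> M \<longrightarrow> x \<in> I} \<inter> B"
      using down[of x] B_sub by blast
  next
    fix x assume "x \<in> {x \<in> carrier R. \<forall>I. ideal I R \<longrightarrow> R Quot I \<in> M \<longrightarrow> x \<in> I} \<inter> B"
    then have "x \<in> B" "\<And>I. ideal I R \<Longrightarrow> R Quot I \<in> M \<Longrightarrow> x \<in> I"
      by simp_all
    then show "x \<in> {x \<in> carrier (R\<lparr>carrier := B\<rparr>). \<forall>J. ideal J (R\<lparr>carrier := B\<rparr>) \<longrightarrow>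
        R\<lparr>carrier := B\<rparr> Quot J \<in> M \<longrightarrow> x \<in> J}"
      using up[of x] by simp
  qed
qed

section \<open>Von Neumann regularity\<close>

text \<open>
  A central element \<open>z\<close> is read as an open piece of the spectrum of the centre, on which \<open>s\<close> coincides
  with an element of \<open>B\<close>.
\<close>

definition locally_equal_on :: "('a, 'm) ring_scheme \<Rightarrow> 'a set \<Rightarrow> 'a \<Rightarrow> 'a set" where
  "locally_equal_on A B s = {z. central_in A z \<and> (\<exists>b\<in>B. s \<otimes>\<^bsub>A\<^esub> z = b \<otimes>\<^bsub>A\<^esub> z)}"

text \<open>
  This says that \<open>1\<close> is a finite sum of elements of \<^const>\<open>locally_equal_on\<close>, that is, that the pieces on
  which \<open>s\<close> agrees with \<open>B\<close> cover everything. Quantifying over the additively closed sets of central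
  elements avoids finite families, and the set \<open>N\<close> can be chosen freely when the property is used.
\<close>

definition locally_in :: "('a, 'm) ring_scheme \<Rightarrow> 'a set \<Rightarrow> 'a \<Rightarrow> bool" where
  "locally_in A B s \<longleftrightarrow> (\<forall>N. N \<subseteq> Collect (central_in A) \<longrightarrow> (\<forall>z\<in>N. \<forall>w\<in>N. z \<oplus>\<^bsub>A\<^esub> w \<in> N) \<longrightarrow>
     locally_equal_on A B s \<subseteq> N \<longrightarrow> \<one>\<^bsub>A\<^esub> \<in> N)"

lemma (in ring) central_in_mult:
  assumes "central_in R z" "central_in R w"
  shows "central_in R (z \<otimes> w)"
  unfolding central_in_def
proof (intro conjI ballI)
  have c: "z \<in> carrier R" "w \<in> carrier R" using assms unfolding central_in_def by auto
  then show "z \<otimes> w \<in> carrier R" by simp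
  fix x assume x: "x \<in> carrier R"
  have "w \<otimes> x = x \<otimes> w" "z \<otimes> x = x \<otimes> z"
    using assms x unfolding central_in_def by blast+
  have "z \<otimes> w \<otimes> x = z \<otimes> (w \<otimes> x)" using c x by (simp add: m_assoc)
  also have "\<dots> = (z \<otimes> x) \<otimes> w" unfolding \<open>w \<otimes> x = x \<otimes> w\<close> using c x by (simp add: m_assoc)
  also have "\<dots> = x \<otimes> (z \<otimes> w)" unfolding \<open>z \<otimes> x = x \<otimes> z\<close> using c x by (simp add: m_assoc)
  finally show "z \<otimes> w \<otimes> x = x \<otimes> (z \<otimes> w)" .
qed

text \<open>
  Common refinement of two coverings: if \<open>1 = \<Sum> z\<^sub>i\<close> and \<open>1 = \<Sum> w\<^sub>j\<close>, then \<open>1 = \<Sum> z\<^sub>i w\<^sub>j\<close>. For a fixed piece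
  \<open>z\<close> the second covering is applied to the set of all \<open>w\<close> with \<open>z w \<in> N\<close>.
\<close>

lemma (in ring) locally_in_combine:
  assumes s: "locally_in R B s" and t: "locally_in R B t"
    and comb: "\<And>z w. z \<in> locally_equal_on R B s \<Longrightarrow> w \<in> locally_equal_on R B t \<Longrightarrow>
      z \<otimes> w \<in> locally_equal_on R B u"
  shows "locally_in R B u"
  unfolding locally_in_def
proof (intro allI impI)
  fix N assume N: "N \<subseteq> Collect (central_in R)" "\<forall>z\<in>N. \<forall>w\<in>N. z \<oplus> w \<in> N"
    "locally_equal_on R B u \<subseteq> N"
  have "locally_equal_on R B s \<subseteq> N"
  proof
    fix z assume z: "z \<in> locally_equal_on R B s"
    then have zc: "z \<in> carrier R" unfolding locally_equal_on_def central_in_def by simp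
    let ?N' = "{w. central_in R w \<and> z \<otimes> w \<in> N}"
    have "\<one> \<in> ?N'"
    proof (rule t[unfolded locally_in_def, rule_format])
      show "?N' \<subseteq> Collect (central_in R)" by blast
      show "locally_equal_on R B t \<subseteq> ?N'"
        using comb[OF z] N(3) unfolding locally_equal_on_def by blast
    next
      fix v w assume "v \<in> ?N'" "w \<in> ?N'"
      then show "v \<oplus> w \<in> ?N'"
        using zc N(2) by (auto simp: central_in_def l_distr r_distr)
    qed
    then show "z \<in> N" using zc by simp
  qed
  then show "\<one> \<in> N"
    using s N(1,2) unfolding locally_in_def by blast
qed

text \<open>
  An idempotent \<open>e\<close> agrees with \<open>1\<close> on the piece \<open>e\<close> and with \<open>0\<close> on the piece \<open>1 - e\<close>; sums and products are
  handled on a common refinement.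
\<close>

lemma (in ring) generated_by_central_idempotents_locally_in:
  assumes B: "subring B R" and E: "\<And>e. e \<in> E \<Longrightarrow> central_in R e \<and> e \<otimes> e = e"
    and s: "s \<in> generate_ring R (B \<union> E)"
  shows "locally_in R B s"
proof -
  note B_sub = subringE(1)[OF B, THEN subsetD]
  have sub: "B \<union> E \<subseteq> carrier R"
    using B_sub E unfolding central_in_def by blast
  note carr = generate_ring_in_carrier[OF sub]
  have le: "z \<in> carrier R \<and> (\<forall>x\<in>carrier R. z \<otimes> x = x \<otimes> z) \<and> (\<exists>b\<in>B. h \<otimes> z = b \<otimes> z)"
    if "z \<in> locally_equal_on R B h" for h z
    using that unfolding locally_equal_on_def central_in_def by blast
  have one: "central_in R \<one>" unfolding central_in_def by simp
  have memB: "locally_in R B b" if b: "b \<in> B" for b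
  proof -
    have "\<one> \<in> locally_equal_on R B b"
      using b one unfolding locally_equal_on_def by blast
    then show ?thesis unfolding locally_in_def by blast
  qed
  show ?thesis
    using s
  proof induction
    case one
    show ?case by (rule memB[OF subringE(3)[OF B]])
  next
    case (incl h)
    show ?case
    proof (cases "h \<in> B")
      case False
      with incl have h: "central_in R h" "h \<otimes> h = h" using E by blast+
      then have c: "h \<in> carrier R" unfolding central_in_def by blast
      have "(\<one> \<ominus> h) \<otimes> x = x \<otimes> (\<one> \<ominus> h)" if x: "x \<in> carrier R" for x
      proof -
        have "h \<otimes> x = x \<otimes> h" using h(1) x unfolding central_in_def by blast
        then show ?thesis using c x by (simp add: minus_eq l_distr r_distr l_minus r_minus)
      qed
      then have "central_in R (\<one> \<ominus> h)"
        using c unfolding central_in_def by simp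
      moreover have "h \<otimes> (\<one> \<ominus> h) = \<zero> \<otimes> (\<one> \<ominus> h)"
        using c h(2) by (simp add: minus_eq r_distr r_minus r_neg)
      moreover have "h \<otimes> h = \<one> \<otimes> h" using c h(2) by simp
      ultimately have "\<one> \<ominus> h \<in> locally_equal_on R B h" "h \<in> locally_equal_on R B h"
        using h(1) subringE(2,3)[OF B] unfolding locally_equal_on_def by blast+
      moreover have "\<one> \<ominus> h \<oplus> h = \<one>" using c by (simp add: minus_eq a_assoc l_neg)
      ultimately show ?thesis unfolding locally_in_def by (metis subsetD)
    qed (rule memB)
  next
    case (a_inv h)
    have c: "h \<in> carrier R" using carr a_inv by blast
    have "locally_equal_on R B h \<subseteq> locally_equal_on R B (\<ominus> h)"
    proof
      fix z assume z: "z \<in> locally_equal_on R B h"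
      obtain b where b: "z \<in> carrier R" "b \<in> B" "h \<otimes> z = b \<otimes> z" using le[OF z] by blast
      then have "\<ominus> h \<otimes> z = \<ominus> b \<otimes> z" using c B_sub by (simp add: l_minus)
      then show "z \<in> locally_equal_on R B (\<ominus> h)"
        using z b(2) subringE(5)[OF B] unfolding locally_equal_on_def by blast
    qed
    then show ?case
      using a_inv.IH unfolding locally_in_def by (meson order_trans)
  next
    case (eng_add h g)
    have c: "h \<in> carrier R" "g \<in> carrier R" using carr eng_add by blast+
    show ?case
    proof (rule locally_in_combine[OF eng_add.IH])
      fix z w assume z: "z \<in> locally_equal_on R B h" and w: "w \<in> locally_equal_on R B g"
      obtain b d where bd: "b \<in> B" "h \<otimes> z = b \<otimes> z" "d \<in> B" "g \<otimes> w = d \<otimes> w"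
        using le[OF z] le[OF w] by blast
      have zw: "z \<in> carrier R" "w \<in> carrier R" "b \<in> carrier R" "d \<in> carrier R"
        using le[OF z] le[OF w] B_sub bd(1,3) by blast+
      have com: "z \<otimes> w = w \<otimes> z" using le[OF z] zw by blast
      have "h \<otimes> (z \<otimes> w) = b \<otimes> (z \<otimes> w)" "g \<otimes> (w \<otimes> z) = d \<otimes> (w \<otimes> z)"
        using bd zw c by (simp_all add: m_assoc[symmetric])
      then have "(h \<oplus> g) \<otimes> (z \<otimes> w) = (b \<oplus> d) \<otimes> (z \<otimes> w)"
        using zw c com by (simp add: l_distr)
      then show "z \<otimes> w \<in> locally_equal_on R B (h \<oplus> g)"
        using z w central_in_mult bd(1,3) subringE(7)[OF B] unfolding locally_equal_on_def by blast
    qed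
  next
    case (eng_mult h g)
    have c: "h \<in> carrier R" "g \<in> carrier R" using carr eng_mult by blast+
    show ?case
    proof (rule locally_in_combine[OF eng_mult.IH])
      fix z w assume z: "z \<in> locally_equal_on R B h" and w: "w \<in> locally_equal_on R B g"
      obtain b d where bd: "b \<in> B" "h \<otimes> z = b \<otimes> z" "d \<in> B" "g \<otimes> w = d \<otimes> w"
        using le[OF z] le[OF w] by blast
      have zw: "z \<in> carrier R" "w \<in> carrier R" "b \<in> carrier R" "d \<in> carrier R"
        using le[OF z] le[OF w] B_sub bd(1,3) by blast+
      have comz: "z \<otimes> x = x \<otimes> z" if "x \<in> carrier R" for x using le[OF z] that by blast
      have "(h \<otimes> g) \<otimes> (z \<otimes> w) = h \<otimes> (g \<otimes> z) \<otimes> w" using zw c by (simp add: m_assoc)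
      also have "\<dots> = (h \<otimes> z) \<otimes> (g \<otimes> w)" using zw c comz[of g, symmetric] by (simp add: m_assoc)
      also have "\<dots> = b \<otimes> (z \<otimes> d) \<otimes> w" using zw bd by (simp add: m_assoc)
      also have "\<dots> = (b \<otimes> d) \<otimes> (z \<otimes> w)" using zw comz[of d] by (simp add: m_assoc)
      finally show "z \<otimes> w \<in> locally_equal_on R B (h \<otimes> g)"
        using z w central_in_mult bd(1,3) subringE(6)[OF B] unfolding locally_equal_on_def by blast
    qed
  qed
qed

text \<open>
  Let \<open>a = a s a\<close>. Wherever \<open>s\<close> agrees with an element \<open>b\<close> of \<open>B\<close>, the element \<open>b\<close> is a quasi-inverse of \<open>a\<close>.
  Two local quasi-inverses \<open>u\<close> and \<open>v\<close> from \<open>B\<close> are glued to \<open>x = u + v - u a v\<close>: from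
  \<open>a - a x a = (a - a u a) (1 - v a) = (1 - a u) (a - a v a)\<close> one sees that \<open>x\<close> works wherever \<open>u\<close> or
  \<open>v\<close> does. So the central elements on which \<open>a\<close> has a quasi-inverse from \<open>B\<close> are closed under addition,
  and a covering by such pieces yields a global quasi-inverse.
\<close>

theorem (in ring) von_neumann_regular_subring:
  assumes B: "subring B R" and E: "\<And>e. e \<in> E \<Longrightarrow> central_in R e \<and> e \<otimes> e = e"
    and gen: "carrier R = generate_ring R (B \<union> E)" and reg: "von_neumann_regular R"
  shows "von_neumann_regular (R\<lparr>carrier := B\<rparr>)"
proof -
  note B_sub = subringE(1)[OF B, THEN subsetD]
  have "\<exists>x\<in>B. a \<otimes> x \<otimes> a = a" if a: "a \<in> B" for a
  proof -
    have ac: "a \<in> carrier R" using a B_sub by blast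
    obtain s where s: "s \<in> carrier R" "a \<otimes> s \<otimes> a = a"
      using reg ac unfolding von_neumann_regular_def by blast
    define N where "N = {z. central_in R z \<and> (\<exists>x\<in>B. a \<otimes> x \<otimes> a \<otimes> z = a \<otimes> z)}"
    have "\<one> \<in> N"
    proof (rule generated_by_central_idempotents_locally_in[OF B E, of E s, unfolded locally_in_def,
          rule_format])
      show "s \<in> generate_ring R (B \<union> E)" using s gen by simp
      show "N \<subseteq> Collect (central_in R)" unfolding N_def by blast
    next
      fix z w assume "z \<in> N" "w \<in> N"
      then obtain u v where uv: "u \<in> B" "v \<in> B" "a \<otimes> u \<otimes> a \<otimes> z = a \<otimes> z" "a \<otimes> v \<otimes> a \<otimes> w = a \<otimes> w"
        and zw: "central_in R z" "central_in R w" unfolding N_def by blast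
      have c: "u \<in> carrier R" "v \<in> carrier R" "z \<in> carrier R" "w \<in> carrier R"
        using uv(1,2) B_sub zw unfolding central_in_def by auto
      define x where "x = u \<oplus> v \<oplus> \<ominus> (u \<otimes> a \<otimes> v)"
      have x: "x \<in> B"
        unfolding x_def using a uv subringE(5-7)[OF B] by simp
      have axa: "a \<otimes> x \<otimes> a \<otimes> y = a \<otimes> u \<otimes> a \<otimes> y \<oplus> a \<otimes> v \<otimes> a \<otimes> y \<oplus> \<ominus> (a \<otimes> u \<otimes> a \<otimes> v \<otimes> a \<otimes> y)"
        if "y \<in> carrier R" for y
        unfolding x_def using ac c that
        by (simp add: l_distr r_distr l_minus r_minus m_assoc)
      \<comment> \<open>on \<open>z\<close> the correction term \<open>a u a v a\<close> equals \<open>a v a\<close>, on \<open>w\<close> it equals \<open>a u a\<close>\<close>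
      have "a \<otimes> u \<otimes> a \<otimes> v \<otimes> a \<otimes> z = (a \<otimes> u \<otimes> a \<otimes> z) \<otimes> (v \<otimes> a)"
        using zw(1) ac c unfolding central_in_def by (simp add: m_assoc)
      also have "\<dots> = a \<otimes> v \<otimes> a \<otimes> z"
        using zw(1) ac c unfolding uv(3) central_in_def by (simp add: m_assoc)
      finally have "a \<otimes> x \<otimes> a \<otimes> z = a \<otimes> z"
        using axa[OF c(3)] ac c uv(3) by (simp add: a_assoc r_neg)
      moreover have "a \<otimes> u \<otimes> a \<otimes> v \<otimes> a \<otimes> w = a \<otimes> u \<otimes> (a \<otimes> v \<otimes> a \<otimes> w)"
        using ac c by (simp add: m_assoc)
      then have "a \<otimes> u \<otimes> a \<otimes> v \<otimes> a \<otimes> w = a \<otimes> u \<otimes> a \<otimes> w"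
        using ac c unfolding uv(4) by (simp add: m_assoc)
      then have "a \<otimes> x \<otimes> a \<otimes> w = a \<otimes> w"
        using axa[OF c(4)] ac c uv(4) by (simp add: a_ac r_neg)
      ultimately have "a \<otimes> x \<otimes> a \<otimes> (z \<oplus> w) = a \<otimes> (z \<oplus> w)"
        using ac c x B_sub by (simp add: r_distr)
      moreover have "central_in R (z \<oplus> w)"
        using zw unfolding central_in_def by (simp add: l_distr r_distr)
      ultimately show "z \<oplus> w \<in> N" using x unfolding N_def by blast
    next
      show "locally_equal_on R B s \<subseteq> N"
      proof
        fix z assume "z \<in> locally_equal_on R B s"
        then obtain b where z: "central_in R z" and b: "b \<in> B" "s \<otimes> z = b \<otimes> z"
          unfolding locally_equal_on_def by blast
        have c: "z \<in> carrier R" "b \<in> carrier R" "a \<otimes> z = z \<otimes> a"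
          using z b(1) B_sub ac unfolding central_in_def by auto
        have "a \<otimes> b \<otimes> a \<otimes> z = a \<otimes> (b \<otimes> z) \<otimes> a" using ac c by (simp add: m_assoc)
        also have "\<dots> = (a \<otimes> s \<otimes> a) \<otimes> z"
          unfolding b(2)[symmetric] using ac c s(1) by (simp add: m_assoc)
        finally have "a \<otimes> b \<otimes> a \<otimes> z = a \<otimes> z" using s(2) by simp
        then show "z \<in> N" using z b(1) unfolding N_def by blast
      qed
    qed
    then obtain x where "x \<in> B" "a \<otimes> x \<otimes> a \<otimes> \<one> = a \<otimes> \<one>" unfolding N_def by blast
    then show ?thesis using ac B_sub by auto
  qed
  then show ?thesis unfolding von_neumann_regular_def by simp
qed

section \<open>Adjoining idempotents that are central modulo the prime radical\<close>

theorem theorem1p14: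
  fixes T :: "('a, 'b) ring_scheme" and R S E :: "'a set"
  assumes "ring T"
    and "subring R T"
    and "E \<noteq> {}"
    and "E \<subseteq> idempotents_central_mod_prime_radical T"
    and "S = generate_ring T (R \<union> E)"
  shows "(\<forall>M :: 'a set ring set. special_class M \<longrightarrow>
            upper_radical M (T\<lparr>carrier := R\<rparr>) = upper_radical M (T\<lparr>carrier := S\<rparr>) \<inter> R) \<and>
         classical_krull_dim (T\<lparr>carrier := S\<rparr>) = classical_krull_dim (T\<lparr>carrier := R\<rparr>) \<and>
         (von_neumann_regular (T\<lparr>carrier := S\<rparr>) \<longrightarrow> von_neumann_regular (T\<lparr>carrier := R\<rparr>))"
proof -
  interpret T: ring T by fact
  let ?S = "T\<lparr>carrier := S\<rparr>"
  note E = T.idempotents_central_mod_prime_radicalD[OF subsetD[OF assms(4)]]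
  have RE: "R \<union> E \<subseteq> carrier T"
    using subringE(1)[OF assms(2)] E(1) by blast
  have S: "subring S T"
    unfolding assms(5) by (rule T.generate_ring_is_subring[OF RE])
  interpret S: ring ?S using S by (rule T.subring_is_ring)
  note S_sub = subringE(1)[OF S, THEN subsetD]
  have RES: "R \<union> E \<subseteq> S"
    unfolding assms(5) by (auto intro: generate_ring.incl)
  have R: "subring R ?S"
    by (rule S.ring_incl_imp_subring) (use RES T.subring_is_ring[OF assms(2)] in auto)
  have gen: "carrier ?S = generate_ring ?S (R \<union> E)"
    using T.subring_gen_equality[OF S RES] assms(5) by simp
  \<comment> \<open>\<open>e\<close> commutes with \<open>S\<close> up to the prime radical of \<open>T\<close>; the difference stays in \<open>S\<close>, so it lies in \<open>prime_radical T \<inter> S\<close>\<close>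
  have comm: "e \<otimes>\<^bsub>?S\<^esub> y \<ominus>\<^bsub>?S\<^esub> y \<otimes>\<^bsub>?S\<^esub> e \<in> prime_radical T \<inter> S"
    if e: "e \<in> E" and y: "y \<in> S" for e y
  proof -
    have ey: "e \<otimes>\<^bsub>T\<^esub> y \<in> S" "y \<otimes>\<^bsub>T\<^esub> e \<in> S"
      using e y RES subringE(6)[OF S] by auto
    have "e \<otimes>\<^bsub>?S\<^esub> y \<ominus>\<^bsub>?S\<^esub> y \<otimes>\<^bsub>?S\<^esub> e = e \<otimes>\<^bsub>T\<^esub> y \<ominus>\<^bsub>T\<^esub> y \<otimes>\<^bsub>T\<^esub> e"
      using T.subring_a_inv[OF S ey(2)] by (simp add: a_minus_def)
    moreover have "\<dots> \<in> S"
      using ey subringE(5,7)[OF S] by (simp add: a_minus_def)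
    ultimately show ?thesis using E(3)[OF e S_sub[OF y]] by simp
  qed
  have cover: "carrier ?S \<subseteq> R <+>\<^bsub>?S\<^esub> P" if P: "prime_ideal P ?S" for P
  proof (rule S.generated_by_idempotents_cover_prime_factor[OF R gen _ P])
    show "e \<otimes>\<^bsub>?S\<^esub> e = e" if "e \<in> E" for e
      using E(2)[OF that] by simp
    show "e \<otimes>\<^bsub>?S\<^esub> y \<ominus>\<^bsub>?S\<^esub> y \<otimes>\<^bsub>?S\<^esub> e \<in> P" if "e \<in> E" "y \<in> carrier ?S" for e y
      using comm[OF that(1)] that(2) T.prime_radical_Int_prime_of_subring[OF S P] by auto
  qed
  have "upper_radical M (T\<lparr>carrier := R\<rparr>) = upper_radical M ?S \<inter> R"
    if "special_class M" for M :: "'a set ring set"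
    using S.upper_radical_subring[OF that R cover] by simp
  moreover have "classical_krull_dim ?S = classical_krull_dim (T\<lparr>carrier := R\<rparr>)"
    using S.classical_krull_dim_subring[OF R cover] by simp
  moreover have "von_neumann_regular (T\<lparr>carrier := R\<rparr>)" if reg: "von_neumann_regular ?S"
  proof -
    have "central_in ?S e \<and> e \<otimes>\<^bsub>?S\<^esub> e = e" if e: "e \<in> E" for e
    proof -
      have eS: "e \<in> carrier ?S" using e RES by auto
      have "e \<otimes>\<^bsub>?S\<^esub> y = y \<otimes>\<^bsub>?S\<^esub> e" if y: "y \<in> carrier ?S" for y
      proof -
        have "e \<otimes>\<^bsub>?S\<^esub> y \<ominus>\<^bsub>?S\<^esub> y \<otimes>\<^bsub>?S\<^esub> e = \<zero>\<^bsub>?S\<^esub>"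
          using comm[OF e, of y] y T.prime_radical_Int_regular_subring[OF S reg] by auto
        then show ?thesis
          using S.r_right_minus_eq S.m_closed eS y by blast
      qed
      moreover have "e \<otimes>\<^bsub>?S\<^esub> e = e" using E(2)[OF e] by simp
      ultimately show ?thesis using eS unfolding central_in_def by blast
    qed
    from S.von_neumann_regular_subring[OF R this gen reg] show ?thesis by simp
  qed
  ultimately show ?thesis by blast
qed

end
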